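(* Let $A$ be a commutative ring and let $F(X)$ be a non-constant monic polynomial in $A[X]$, of degree $n$. For any $f(X)$ in $A[X]$ let $\mu_F(f)$ be the $A$-linear endomorphism of $A[X]/(F(X))$ given as multiplication by the residue class of $f(X)$ modulo the ideal $(F(X))$. Then the characteristic polynomial of $\mu_F(f)$ is $$X^n-u_F(s_{1,n}(f(X)))X^{n-1}+\dots+(-1)^nu_F(s_{n,n}(f(X))).$$ In particular $u_F(f(X)\otimes\dots\otimes f(X))$ is the determinant of $\mu_F(f)$.
   Context: Symmetric operators: let $\otimes_A^nA[X]$ be the $n$-fold tensor product of $A[X]$ over $A$. For $f(X)\in A[X]$ let $f(X_i)=1\otimes\cdots\otimes1\otimes f(X)\otimes1\otimes\cdots\otimes1$ with $f(X)$ in the $i$'th place. The symmetric tensors $s_{1,n}(f(X)),\ldots,s_{n,n}(f(X))\in\otimes_A^nA[X]$ are defined by the identity $$\prod_{i=1}^n(X-f(X_i))=X^n-s_{1,n}(f(X))X^{n-1}+\dots+(-1)^ns_{n,n}(f(X))$$ in the polynomial ring in a variable $X$ over $\otimes_A^nA[X]$. So $s_{i,n}(X)$ are the elementary symmetric functions in $X_1,\ldots,X_n$ (where $X_i$ is $f(X_i)$ for $f(X)=X$), and $s_{n,n}(f(X))=f(X)\otimes\dots\otimes f(X)$. The ring of symmetric tensors $\otimes_A^{(n)}A[X]$ is the subring of $\otimes_A^nA[X]$ of invariants under permutation of the factors; it is the polynomial ring over $A$ in $s_{1,n}(X),\ldots,s_{n,n}(X)$. The homomorphism $u_F$: for a monic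 polynomial $F(X)=X^n-u_1X^{n-1}+\dots+(-1)^nu_n$ in $A[X]$, $u_F:\otimes_A^{(n)}A[X]\to A$ is the unique $A$-algebra homomorphism with $u_F(s_{i,n}(X))=u_i$ for $i=1,\ldots,n$. *)

theory Defs
  imports
    "Jordan_Normal_Form.Char_Poly"
    "Jordan_Normal_Form.VS_Connect"
    "HOL-Algebra.QuotRing"
    "HOL-Algebra.Module"
    "HOL-Combinatorics.Perm"
    "HOL-Library.Cardinality"
    "HOL-Library.Poly_Mapping"
begin

hide_const (open) Polynomial.smult

section \<open>Tensor powers of a polynomial algebra\<close>

text \<open>The number \<open>n\<close> of tensor factors is \<open>CARD('n)\<close>, the factors being indexed by the finite
  type \<open>'n\<close>. A value \<open>Symb f\<close> is the formal symbol attached to the family \<open>f\<close>.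
  Symbols are multiplied factor by factor; this commutative monoid is written additively because
  that is what the convolution product of \<^typ>\<open>'k \<Rightarrow>\<^sub>0 'a\<close> requires of the type of keys. Thus
  \<open>('n, 'a poly) symb \<Rightarrow>\<^sub>0 'a\<close> is the free \<open>'a\<close>-module on all families of polynomials, with
  the product that extends the factorwise product of families bilinearly.\<close>

datatype ('n, 'b) symb = Symb (factors: "'n \<Rightarrow> 'b")

instantiation symb :: (type, comm_monoid_mult) comm_monoid_add
begin

definition zero_symb :: "('a, 'b) symb"
  where "zero_symb = Symb (\<lambda>_. 1)"

definition plus_symb :: "('a, 'b) symb \<Rightarrow> ('a, 'b) symb \<Rightarrow> ('a, 'b) symb"
  where "plus_symb x y = Symb (\<lambda>i. factors x i * factors y i)"

instance
proof
  fix x y z :: "('a, 'b) symb"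
  show "x + y + z = x + (y + z)"
    by (simp add: plus_symb_def mult.assoc)
  show "x + y = y + x"
    by (simp add: plus_symb_def mult.commute)
  show "0 + x = x"
    by (simp add: zero_symb_def plus_symb_def)
qed

end

abbreviation formal_tensor :: "('n \<Rightarrow> 'a poly) \<Rightarrow> ('n::finite, 'a::comm_ring_1 poly) symb \<Rightarrow>\<^sub>0 'a"
  where "formal_tensor f \<equiv> Poly_Mapping.single (Symb f) 1"

abbreviation formal_scalar :: "'a \<Rightarrow> ('n::finite, 'a::comm_ring_1 poly) symb \<Rightarrow>\<^sub>0 'a"
  where "formal_scalar a \<equiv> Poly_Mapping.single 0 a"

text \<open>The submodule spanned by the relations of multilinearity; \<open>formal_scalar a * x\<close> is the
  scalar multiple of \<open>x\<close> by \<open>a\<close>.\<close>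

inductive_set multilinear_relations :: "(('n::finite, 'a::comm_ring_1 poly) symb \<Rightarrow>\<^sub>0 'a) set"
  where
    rel_add: "formal_tensor (f(i := p + q)) - formal_tensor (f(i := p)) - formal_tensor (f(i := q))
      \<in> multilinear_relations"
  | rel_scale: "formal_tensor (f(i := Polynomial.smult a p))
      - formal_scalar a * formal_tensor (f(i := p)) \<in> multilinear_relations"
  | rel_zero: "0 \<in> multilinear_relations"
  | rel_plus: "x \<in> multilinear_relations \<Longrightarrow> y \<in> multilinear_relations
      \<Longrightarrow> x + y \<in> multilinear_relations"
  | rel_mult: "x \<in> multilinear_relations \<Longrightarrow> formal_scalar a * x \<in> multilinear_relations"

lemma formal_induct [case_names single sum]:
  fixes x :: "'k \<Rightarrow>\<^sub>0 'a::comm_ring_1"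
  assumes single: "\<And>k c. P (Poly_Mapping.single k c)"
    and sum: "\<And>x y. P x \<Longrightarrow> P y \<Longrightarrow> P (x + y)"
  shows "P x"
proof (induction x rule: Poly_Mapping.update_induct)
  case const
  show ?case using single[of undefined 0] by simp
next
  case (update f k c)
  have "Poly_Mapping.update k c f = f + Poly_Mapping.single k c"
    using update.hyps
    by (intro poly_mapping_eqI)
      (auto simp: lookup_update lookup_add lookup_single when_def in_keys_iff)
  then show ?case using update.IH single sum by simp
qed

lemma symb_add_upd:
  "Symb g + Symb (f(i := p)) = Symb ((\<lambda>j. g j * f j)(i := g i * p))"
  by (auto simp: plus_symb_def)

lemma multilinear_relations_symb_mult:
  assumes "x \<in> multilinear_relations"
  shows "formal_tensor g * x \<in> multilinear_relations"
  using assms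
proof (induction rule: multilinear_relations.induct)
  case (rel_add f i p q)
  have "formal_tensor g * (formal_tensor (f(i := p + q)) - formal_tensor (f(i := p))
      - formal_tensor (f(i := q)))
    = formal_tensor ((\<lambda>j. g j * f j)(i := g i * p + g i * q))
      - formal_tensor ((\<lambda>j. g j * f j)(i := g i * p))
      - formal_tensor ((\<lambda>j. g j * f j)(i := g i * q))"
    by (simp add: right_diff_distrib mult_single symb_add_upd distrib_left)
  then show ?case
    by (simp only: multilinear_relations.rel_add)
next
  case (rel_scale f i a p)
  have "formal_tensor g * (formal_tensor (f(i := Polynomial.smult a p))
      - formal_scalar a * formal_tensor (f(i := p)))
    = formal_tensor ((\<lambda>j. g j * f j)(i := Polynomial.smult a (g i * p)))
      - formal_scalar a * formal_tensor ((\<lambda>j. g j * f j)(i := g i * p))"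
    by (simp add: right_diff_distrib mult_single symb_add_upd)
  then show ?case
    by (simp only: multilinear_relations.rel_scale)
next
  case rel_zero
  then show ?case by (simp add: multilinear_relations.rel_zero)
next
  case (rel_plus x y)
  then show ?case by (simp add: distrib_left multilinear_relations.rel_plus)
next
  case (rel_mult x a)
  then show ?case by (metis mult.left_commute multilinear_relations.rel_mult)
qed

lemma multilinear_relations_uminus:
  assumes "x \<in> multilinear_relations"
  shows "- x \<in> multilinear_relations"
proof -
  have "formal_scalar (- 1) * x \<in> multilinear_relations"
    using assms by (rule rel_mult)
  moreover have "formal_scalar (- 1) * x = - x"
    by (simp add: single_uminus)
  ultimately show ?thesis by simp
qed

lemma multilinear_relations_mult:
  assumes "x \<in> multilinear_relations"
  shows "y * x \<in> multilinear_relations"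
proof (induction y rule: formal_induct)
  case (single k c)
  have "Poly_Mapping.single k c * x = formal_scalar c * (formal_tensor (factors k) * x)"
    by (simp add: mult_single flip: mult.assoc)
  then show ?case
    using rel_mult[OF multilinear_relations_symb_mult[OF assms, of "factors k"], of c] by simp
next
  case (sum x y)
  then show ?case by (simp add: distrib_right rel_plus)
qed

definition tensor_cong :: "(('n::finite, 'a::comm_ring_1 poly) symb \<Rightarrow>\<^sub>0 'a) \<Rightarrow> (('n, 'a poly) symb \<Rightarrow>\<^sub>0 'a) \<Rightarrow> bool"
  where "tensor_cong x y \<longleftrightarrow> x - y \<in> multilinear_relations"

lemma tensor_cong_refl: "tensor_cong x x"
  by (simp add: tensor_cong_def rel_zero)

lemma tensor_cong_plus:
  "tensor_cong x x' \<Longrightarrow> tensor_cong y y' \<Longrightarrow> tensor_cong (x + y) (x' + y')"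
  unfolding tensor_cong_def by (drule (1) rel_plus) (simp add: algebra_simps)

lemma tensor_cong_uminus: "tensor_cong x x' \<Longrightarrow> tensor_cong (- x) (- x')"
  unfolding tensor_cong_def by (drule multilinear_relations_uminus) simp

lemma tensor_cong_times:
  assumes "tensor_cong x x'" "tensor_cong y y'"
  shows "tensor_cong (x * y) (x' * y')"
proof -
  have "y * (x - x') + x' * (y - y') \<in> multilinear_relations"
    using assms unfolding tensor_cong_def by (intro rel_plus multilinear_relations_mult)
  then show ?thesis
    unfolding tensor_cong_def by (simp add: algebra_simps)
qed

lemma equivp_tensor_cong: "equivp tensor_cong"
proof (rule equivpI)
  show "reflp tensor_cong"
    by (simp add: reflp_def tensor_cong_refl)
  show "symp tensor_cong"
    using multilinear_relations_uminus by (fastforce simp: symp_def tensor_cong_def)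
  show "transp tensor_cong"
    unfolding transp_def tensor_cong_def using rel_plus by fastforce
qed

text \<open>\<open>('a, 'n) tensor_power\<close> is the tensor product over \<open>'a\<close> of copies of the polynomial algebra
  \<open>'a poly\<close>, one for each element of \<open>'n\<close>.\<close>

quotient_type (overloaded) ('a, 'n) tensor_power =
    "('n::finite, 'a::comm_ring_1 poly) symb \<Rightarrow>\<^sub>0 'a" / tensor_cong
  by (rule equivp_tensor_cong)

lift_definition tensor :: "('n \<Rightarrow> 'a poly) \<Rightarrow> ('a::comm_ring_1, 'n::finite) tensor_power"
  is formal_tensor .

lift_definition tensor_scalar :: "'a \<Rightarrow> ('a::comm_ring_1, 'n::finite) tensor_power"
  is formal_scalar .

text \<open>The homomorphism from the free module to \<open>'a\<close> evaluating every polynomial at \<open>0\<close> shows that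
  the tensor power is not the zero ring.\<close>

definition eval0 :: "(('n::finite, 'a::comm_ring_1 poly) symb \<Rightarrow>\<^sub>0 'a) \<Rightarrow> 'a"
  where "eval0 x =
    (\<Sum>k\<in>Poly_Mapping.keys x. Poly_Mapping.lookup x k * (\<Prod>i\<in>UNIV. poly (factors k i) 0))"

lemma eval0_superset:
  assumes "finite S" "Poly_Mapping.keys x \<subseteq> S"
  shows "eval0 x = (\<Sum>k\<in>S. Poly_Mapping.lookup x k * (\<Prod>i\<in>UNIV. poly (factors k i) 0))"
  unfolding eval0_def using assms by (intro sum.mono_neutral_left) (auto simp: in_keys_iff)

lemma eval0_add: "eval0 (x + y) = eval0 x + eval0 y"
proof -
  let ?S = "Poly_Mapping.keys x \<union> Poly_Mapping.keys y"
  have "Poly_Mapping.keys (x + y) \<subseteq> ?S"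
    by (rule keys_add)
  then show ?thesis
    by (simp add: eval0_superset[of ?S] lookup_add distrib_right sum.distrib)
qed

lemma eval0_single: "eval0 (Poly_Mapping.single k c) = c * (\<Prod>i\<in>UNIV. poly (factors k i) 0)"
  by (subst eval0_superset[of "{k}"]) auto

lemma eval0_diff: "eval0 (x - y) = eval0 x - eval0 y"
  using eval0_add[of "x - y" y] by simp

lemma eval0_scalar: "eval0 (formal_scalar a * x) = a * eval0 x"
proof (induction x rule: formal_induct)
  case (single k v)
  then show ?case by (simp add: mult_single eval0_single)
next
  case (sum x y)
  then show ?case by (simp add: distrib_left eval0_add)
qed

lemma eval0_relations: "x \<in> multilinear_relations \<Longrightarrow> eval0 x = 0"
proof (induction rule: multilinear_relations.induct)
  case (rel_add f i p q)
  show ?case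
    by (simp add: eval0_diff eval0_single prod.remove[of UNIV i] distrib_right)
next
  case (rel_scale f i a p)
  show ?case
    by (simp add: eval0_diff eval0_scalar eval0_single prod.remove[of UNIV i])
next
  case rel_zero
  show ?case by (simp add: eval0_def)
next
  case (rel_plus x y)
  then show ?case by (simp add: eval0_add)
next
  case (rel_mult x a)
  then show ?case by (simp add: eval0_scalar)
qed

instantiation tensor_power :: (comm_ring_1, finite) comm_ring_1
begin

lift_definition zero_tensor_power :: "('a, 'b) tensor_power" is 0 .

lift_definition one_tensor_power :: "('a, 'b) tensor_power" is 1 .

lift_definition plus_tensor_power ::
    "('a, 'b) tensor_power \<Rightarrow> ('a, 'b) tensor_power \<Rightarrow> ('a, 'b) tensor_power"
  is plus by (rule tensor_cong_plus)

lift_definition uminus_tensor_power :: "('a, 'b) tensor_power \<Rightarrow> ('a, 'b) tensor_power"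
  is uminus by (rule tensor_cong_uminus)

lift_definition minus_tensor_power ::
    "('a, 'b) tensor_power \<Rightarrow> ('a, 'b) tensor_power \<Rightarrow> ('a, 'b) tensor_power"
  is minus
  using tensor_cong_plus tensor_cong_uminus by fastforce

lift_definition times_tensor_power ::
    "('a, 'b) tensor_power \<Rightarrow> ('a, 'b) tensor_power \<Rightarrow> ('a, 'b) tensor_power"
  is times by (rule tensor_cong_times)

instance
proof
  fix s t u :: "('a, 'b) tensor_power"
  show "s + t + u = s + (t + u)"
    by transfer (simp only: add.assoc tensor_cong_refl)
  show "s + t = t + s"
    by transfer (simp only: add.commute tensor_cong_refl)
  show "0 + s = s"
    by transfer (simp only: add_0_left tensor_cong_refl)
  show "- s + s = 0"
    by transfer (simp only: left_minus tensor_cong_refl)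
  show "s - t = s + - t"
    by transfer (simp only: diff_conv_add_uminus tensor_cong_refl)
  show "s * t * u = s * (t * u)"
    by transfer (simp only: mult.assoc tensor_cong_refl)
  show "s * t = t * s"
    by transfer (simp only: mult.commute tensor_cong_refl)
  show "1 * s = s"
    by transfer (simp only: mult_1_left tensor_cong_refl)
  show "(s + t) * u = s * u + t * u"
    by transfer (simp only: distrib_right tensor_cong_refl)
  show "(0 :: ('a, 'b) tensor_power) \<noteq> 1"
  proof (transfer, rule notI)
    assume "tensor_cong (0 :: ('b, 'a poly) symb \<Rightarrow>\<^sub>0 'a) 1"
    then have "eval0 (0 - 1 :: ('b, 'a poly) symb \<Rightarrow>\<^sub>0 'a) = 0"
      unfolding tensor_cong_def by (rule eval0_relations)
    moreover have "eval0 (1 :: ('b, 'a poly) symb \<Rightarrow>\<^sub>0 'a) = 1"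
      unfolding single_one[symmetric] by (simp add: eval0_single zero_symb_def)
    ultimately show False
      by (simp add: eval0_diff) (simp add: eval0_def)
  qed
qed

end

section \<open>Symmetric tensors\<close>

definition permute_symb :: "'n perm \<Rightarrow> ('n, 'b) symb \<Rightarrow> ('n, 'b) symb"
  where "permute_symb \<sigma> k = Symb (factors k \<circ> Perm.apply \<sigma>)"

lemma apply_inverse_cancel:
  "Perm.apply (inverse \<sigma>) (Perm.apply \<sigma> i) = i"
  "Perm.apply \<sigma> (Perm.apply (inverse \<sigma>) i) = i"
  by (simp_all add: apply_inverse bij_is_inj bij_is_surj inv_f_f surj_f_inv_f)

lemma inj_permute_symb: "inj (permute_symb \<sigma> :: ('n, 'b) symb \<Rightarrow> _)"
proof (rule injI)
  fix x y :: "('n, 'b) symb"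
  assume "permute_symb \<sigma> x = permute_symb \<sigma> y"
  then have "factors x \<circ> Perm.apply \<sigma> = factors y \<circ> Perm.apply \<sigma>"
    by (simp add: permute_symb_def)
  then have "factors x j = factors y j" for j
    by (metis apply_inverse_cancel(2) comp_apply)
  then have "factors x = factors y" by (rule ext)
  then show "x = y" by (cases x; cases y) simp
qed

text \<open>Reindexing the keys by \<open>permute_symb \<sigma>\<close> sends the symbol of \<open>permute_symb \<sigma> k\<close> to that of
  \<open>k\<close>, so that the factor in place \<open>i\<close> is moved to place \<open>\<sigma> i\<close>; see \<open>permute_tensor_tensor\<close>
  below.\<close>

abbreviation permute_formal ::
    "'n perm \<Rightarrow> (('n::finite, 'a::comm_ring_1 poly) symb \<Rightarrow>\<^sub>0 'a) \<Rightarrow> (('n, 'a poly) symb \<Rightarrow>\<^sub>0 'a)"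
  where "permute_formal \<sigma> \<equiv> Poly_Mapping.map_key (permute_symb \<sigma>)"

lemma permute_formal_single:
  "permute_formal \<sigma> (Poly_Mapping.single (Symb f) c)
    = Poly_Mapping.single (Symb (f \<circ> Perm.apply (inverse \<sigma>))) c"
proof -
  have "permute_symb \<sigma> (Symb (f \<circ> Perm.apply (inverse \<sigma>))) = Symb f"
    by (simp add: permute_symb_def comp_def apply_inverse_cancel)
  then show ?thesis
    using map_key_single[OF inj_permute_symb, of \<sigma> "Symb (f \<circ> Perm.apply (inverse \<sigma>))" c]
    by simp
qed

lemma permute_formal_diff:
  "permute_formal \<sigma> (x - y) = permute_formal \<sigma> x - permute_formal \<sigma> y"
  using map_key_plus[OF inj_permute_symb, of \<sigma> "x - y" y] by simp

lemma permute_formal_scalar: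
  "permute_formal \<sigma> (formal_scalar a * x) = formal_scalar a * permute_formal \<sigma> x"
proof (induction x rule: formal_induct)
  case (single k v)
  show ?case
    by (cases k) (simp add: mult_single permute_formal_single)
next
  case (sum x y)
  then show ?case
    by (simp add: distrib_left map_key_plus[OF inj_permute_symb])
qed

lemma permute_upd: "f(i := p) \<circ> Perm.apply (inverse \<sigma>)
    = (f \<circ> Perm.apply (inverse \<sigma>))(Perm.apply \<sigma> i := p)"
  by (rule ext) (auto simp: apply_inverse_cancel)

lemma permute_formal_relations:
  "x \<in> multilinear_relations \<Longrightarrow> permute_formal \<sigma> x \<in> multilinear_relations"
proof (induction rule: multilinear_relations.induct)
  case (rel_add f i p q)
  show ?case
    by (simp only: permute_formal_diff permute_formal_single permute_upd
        multilinear_relations.rel_add)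
next
  case (rel_scale f i a p)
  show ?case
    by (simp only: permute_formal_diff permute_formal_scalar permute_formal_single permute_upd
        multilinear_relations.rel_scale)
next
  case rel_zero
  show ?case by (simp add: multilinear_relations.rel_zero map_key_zero[OF inj_permute_symb])
next
  case (rel_plus x y)
  then show ?case
    by (simp add: map_key_plus[OF inj_permute_symb] multilinear_relations.rel_plus)
next
  case (rel_mult x a)
  then show ?case
    by (simp add: permute_formal_scalar multilinear_relations.rel_mult)
qed

lift_definition permute_tensor ::
    "'n perm \<Rightarrow> ('a::comm_ring_1, 'n::finite) tensor_power \<Rightarrow> ('a, 'n) tensor_power"
  is permute_formal
  unfolding tensor_cong_def permute_formal_diff[symmetric] by (rule permute_formal_relations)

lemma permute_tensor_tensor:
  "permute_tensor \<sigma> (tensor f) = tensor (f \<circ> Perm.apply (inverse \<sigma>))"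
  by transfer (simp add: permute_formal_single tensor_cong_refl)

definition symmetric_tensors :: "('a::comm_ring_1, 'n::finite) tensor_power set"
  where "symmetric_tensors = {t. \<forall>\<sigma>. permute_tensor \<sigma> t = t}"

definition tensor_at :: "'n \<Rightarrow> 'a poly \<Rightarrow> ('a::comm_ring_1, 'n::finite) tensor_power"
  where "tensor_at i f = tensor ((\<lambda>_. 1)(i := f))"

text \<open>\<open>sym_tensor k f\<close> is \<open>s\<^sub>k\<^sub>,\<^sub>n(f)\<close>, with \<open>n = CARD('n)\<close>, read off from the expansion of
  \<open>\<Prod>\<^sub>i (X - f(X\<^sub>i))\<close> over the tensor power, where \<open>(-1)\<^sup>k s\<^sub>k\<^sub>,\<^sub>n(f)\<close> is the coefficient of
  \<open>X\<^sup>n\<^sup>-\<^sup>k\<close>.\<close>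

definition sym_tensor :: "nat \<Rightarrow> 'a poly \<Rightarrow> ('a::comm_ring_1, 'n::finite) tensor_power"
  where "sym_tensor k f =
    (- 1) ^ k * coeff (\<Prod>i\<in>(UNIV :: 'n set). [:0, 1:] - [:tensor_at i f:]) (CARD('n) - k)"

definition is_sym_alg_hom :: "(('a::comm_ring_1, 'n::finite) tensor_power \<Rightarrow> 'a) \<Rightarrow> bool"
  where "is_sym_alg_hom u \<longleftrightarrow>
    u 1 = 1 \<and>
    (\<forall>s\<in>symmetric_tensors. \<forall>t\<in>symmetric_tensors. u (s + t) = u s + u t) \<and>
    (\<forall>s\<in>symmetric_tensors. \<forall>t\<in>symmetric_tensors. u (s * t) = u s * u t) \<and>
    (\<forall>a. \<forall>t\<in>symmetric_tensors. u (tensor_scalar a * t) = a * u t)"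

text \<open>For \<open>F\<close> monic of degree \<open>CARD('n)\<close>, written
  \<open>X\<^sup>n - u\<^sub>1 X\<^sup>n\<^sup>-\<^sup>1 + \<dots> + (-1)\<^sup>n u\<^sub>n\<close>, the number \<open>u\<^sub>i\<close> is \<open>(-1)\<^sup>i\<close> times the coefficient of
  \<open>X\<^sup>n\<^sup>-\<^sup>i\<close>. Being a function on the symmetric tensors only, the homomorphism is taken to be
  \<^const>\<open>undefined\<close> on the other tensors.\<close>

definition u_hom :: "'a poly \<Rightarrow> ('a::comm_ring_1, 'n::finite) tensor_power \<Rightarrow> 'a"
  where "u_hom F = (THE u. u \<in> extensional symmetric_tensors \<and> is_sym_alg_hom u \<and>
    (\<forall>i\<in>{1..CARD('n)}. u (sym_tensor i [:0, 1:]) = (- 1) ^ i * coeff F (CARD('n) - i)))"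

section \<open>Characteristic polynomial of an endomorphism of a free module\<close>

definition has_coords ::
    "('a::comm_ring_1, 'm, 'z) module_scheme \<Rightarrow> 'm list \<Rightarrow> 'm \<Rightarrow> 'a vec \<Rightarrow> bool"
  where "has_coords M bs x c \<longleftrightarrow>
    c \<in> carrier_vec (length bs) \<and> x = (\<Oplus>\<^bsub>M\<^esub>i\<in>{..<length bs}. (c $ i) \<odot>\<^bsub>M\<^esub> (bs ! i))"

definition is_free_basis :: "('a::comm_ring_1, 'm, 'z) module_scheme \<Rightarrow> 'm list \<Rightarrow> bool"
  where "is_free_basis M bs \<longleftrightarrow>
    set bs \<subseteq> carrier M \<and> (\<forall>x\<in>carrier M. \<exists>!c. has_coords M bs x c)"

definition coords :: "('a::comm_ring_1, 'm, 'z) module_scheme \<Rightarrow> 'm list \<Rightarrow> 'm \<Rightarrow> 'a vec"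
  where "coords M bs x = (THE c. has_coords M bs x c)"

definition endo_mat ::
    "('a::comm_ring_1, 'm, 'z) module_scheme \<Rightarrow> 'm list \<Rightarrow> ('m \<Rightarrow> 'm) \<Rightarrow> 'a mat"
  where "endo_mat M bs \<phi> =
    mat (length bs) (length bs) (\<lambda>(i, j). coords M bs (\<phi> (bs ! j)) $ i)"

definition some_basis :: "('a::comm_ring_1, 'm, 'z) module_scheme \<Rightarrow> 'm list"
  where "some_basis M = (SOME bs. is_free_basis M bs)"

text \<open>For a linear endomorphism of a module with a finite basis, the following do not depend on
  the basis; for other modules or maps they carry no meaning.\<close>

definition endo_char_poly :: "('a::comm_ring_1, 'm, 'z) module_scheme \<Rightarrow> ('m \<Rightarrow> 'm) \<Rightarrow> 'a poly"
  where "endo_char_poly M \<phi> = char_poly (endo_mat M (some_basis M) \<phi>)"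

definition endo_det :: "('a::comm_ring_1, 'm, 'z) module_scheme \<Rightarrow> ('m \<Rightarrow> 'm) \<Rightarrow> 'a"
  where "endo_det M \<phi> = det (endo_mat M (some_basis M) \<phi>)"

section \<open>The algebra of polynomials modulo a polynomial\<close>

definition quot_ring :: "'a::comm_ring_1 poly \<Rightarrow> 'a poly set ring"
  where "quot_ring F = class_ring Quot (PIdl\<^bsub>class_ring\<^esub> F)"

definition residue_class :: "'a::comm_ring_1 poly \<Rightarrow> 'a poly \<Rightarrow> 'a poly set"
  where "residue_class F f = PIdl\<^bsub>class_ring\<^esub> F +>\<^bsub>class_ring\<^esub> f"

definition quot_module :: "'a::comm_ring_1 poly \<Rightarrow> ('a, 'a poly set) module"
  where "quot_module F =
    \<lparr>carrier = carrier (quot_ring F), mult = mult (quot_ring F), one = one (quot_ring F),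
     zero = zero (quot_ring F), add = add (quot_ring F),
     smult = (\<lambda>a C. residue_class F [:a:] \<otimes>\<^bsub>quot_ring F\<^esub> C)\<rparr>"

definition mult_endo :: "'a::comm_ring_1 poly \<Rightarrow> 'a poly \<Rightarrow> 'a poly set \<Rightarrow> 'a poly set"
  where "mult_endo F f C = residue_class F f \<otimes>\<^bsub>quot_ring F\<^esub> C"

end

theory Submission
  imports Defs
begin

text \<open>Write \<open>n\<close> for the number of tensor factors, which is the degree of \<open>F\<close>, and \<open>B\<close> for
  \<open>A[X]/(F)\<close>, a free \<open>A\<close>-module of rank \<open>n\<close>. The homomorphism \<open>u\<^sub>F\<close> has a description that makes the
  characteristic polynomial visible: the tensor power acts on itself by multiplication, and the
  determinant of the coordinates of the \<open>n\<close> factors in a basis of \<open>B\<close> is a linear form \<open>D\<close> on it,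
  the composite \<open>\<Otimes>\<^sup>n A[X] \<rightarrow> \<Lambda>\<^sup>n B \<cong> A\<close>.

  Multiplying the tensor \<open>y\<^sub>1 \<otimes> \<dots> \<otimes> y\<^sub>n\<close> by \<open>\<Prod>\<^sub>i (T - f(X\<^sub>i))\<close> replaces each \<open>y\<^sub>i\<close> by
  \<open>(T - f) y\<^sub>i\<close>, that is, it applies \<open>T - \<mu>\<^sub>F(f)\<close> to every row of the determinant. As the determinant
  is multiplicative, \<open>D\<close> is multiplied by \<open>\<chi>\<^sub>f(T)\<close>, the characteristic polynomial of \<open>\<mu>\<^sub>F(f)\<close>.
  Comparing coefficients of \<open>T\<close>, multiplication by \<open>s\<^sub>k(f)\<close> multiplies \<open>D\<close> by the scalar
  \<open>(-1)\<^sup>k\<close> times the coefficient of \<open>T\<^sup>n\<^sup>-\<^sup>k\<close> in \<open>\<chi>\<^sub>f\<close> (\<open>det_form_sym_tensor_mult\<close>).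

  The tensors \<open>s\<close> for which multiplication by \<open>s\<close> multiplies \<open>D\<close> by a scalar \<open>u(s)\<close> form a
  subalgebra on which \<open>u\<close> is an algebra homomorphism. It contains all \<open>s\<^sub>k(X)\<close>, and hence every
  symmetric tensor, because the \<open>s\<^sub>k(X)\<close> generate the algebra of symmetric tensors
  (\<open>symmetric_tensors_eq_elementary_algebra\<close>). For \<open>f = X\<close> the characteristic polynomial is \<open>F\<close>
  itself (\<open>char_poly_mult_X\<close>), so \<open>u\<close> takes on \<open>s\<^sub>k(X)\<close> the value that defines \<open>u\<^sub>F\<close>. Since a
  homomorphism is determined by its values on generators, \<open>u = u\<^sub>F\<close> (\<open>u_hom_eq_det_form\<close>), and
  the values of \<open>u\<close> on the \<open>s\<^sub>k(f)\<close> are the coefficients claimed. The determinant is the case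
  \<open>k = n\<close>.

  The basis of \<open>B\<close> may be arbitrary, since only the number of its elements enters
  (\<open>card_basis_eq_degree\<close>).\<close>

section \<open>Calculus in the tensor power\<close>

lemma tensor_scalar_0 [simp]: "tensor_scalar 0 = 0"
  by transfer (simp add: tensor_cong_refl)

lemma tensor_scalar_1 [simp]: "tensor_scalar 1 = 1"
  by transfer (simp add: tensor_cong_refl)

lemma tensor_scalar_add: "tensor_scalar (a + b) = tensor_scalar a + tensor_scalar b"
  by transfer (simp add: single_add tensor_cong_refl)

lemma tensor_scalar_mult: "tensor_scalar (a * b) = tensor_scalar a * tensor_scalar b"
  by transfer (simp add: mult_single tensor_cong_refl)

lemma tensor_scalar_uminus: "tensor_scalar (- a) = - tensor_scalar a"
  by transfer (simp add: single_uminus tensor_cong_refl)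

lemma tensor_scalar_prod: "tensor_scalar (prod a A) = (\<Prod>i\<in>A. tensor_scalar (a i))"
  by (induction A rule: infinite_finite_induct) (simp_all add: tensor_scalar_mult)

lemma tensor_scalar_power: "tensor_scalar (a ^ m) = tensor_scalar a ^ m"
  by (induction m) (simp_all add: tensor_scalar_mult)

lemma tensor_one [simp]: "tensor (\<lambda>_. 1) = 1"
proof -
  have "formal_tensor (\<lambda>_ :: 'b::finite. 1 :: 'a::comm_ring_1 poly) = 1"
    by (simp add: zero_symb_def[symmetric])
  then show ?thesis by transfer (simp add: tensor_cong_refl)
qed

lemma tensor_mult: "tensor f * tensor g = tensor (\<lambda>i. f i * g i)"
  by transfer (simp add: mult_single plus_symb_def tensor_cong_refl)

lemma tensor_upd_add: "tensor (f(i := p + q)) = tensor (f(i := p)) + tensor (f(i := q))"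
  by transfer (simp add: tensor_cong_def diff_diff_eq[symmetric] rel_add)

lemma tensor_upd_smult: "tensor (f(i := Polynomial.smult a p)) = tensor_scalar a * tensor (f(i := p))"
  by transfer (simp add: tensor_cong_def rel_scale)

text \<open>Coefficients are kept in front of pure tensors because a scalar can be absorbed into a factor
  only after choosing one of the factors.\<close>

lemma tensor_induct [case_names scaled add]:
  fixes t :: "('a::comm_ring_1, 'n::finite) tensor_power"
  assumes scaled: "\<And>a f. P (tensor_scalar a * tensor f)"
    and add: "\<And>s t. P s \<Longrightarrow> P t \<Longrightarrow> P (s + t)"
  shows "P t"
proof (induction t rule: tensor_power.abs_induct)
  fix x :: "('n, 'a poly) symb \<Rightarrow>\<^sub>0 'a"
  show "P (abs_tensor_power x)"
  proof (induction x rule: formal_induct)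
    case (single k c)
    have "Poly_Mapping.single k c = formal_scalar c * formal_tensor (factors k)"
      by (simp add: mult_single)
    then show ?case
      using scaled[of c "factors k"]
      by (simp add: tensor_scalar.abs_eq tensor.abs_eq times_tensor_power.abs_eq)
  next
    case (sum x y)
    then show ?case using add by (simp add: plus_tensor_power.abs_eq[symmetric])
  qed
qed

lemma tensor_at_add: "tensor_at i (p + q) = tensor_at i p + tensor_at i q"
  by (simp add: tensor_at_def tensor_upd_add)

lemma tensor_at_smult: "tensor_at i (Polynomial.smult a p) = tensor_scalar a * tensor_at i p"
  by (simp add: tensor_at_def tensor_upd_smult)

lemma tensor_at_0 [simp]: "tensor_at i 0 = 0"
  using tensor_at_smult[of i 0 0] by simp

lemma tensor_at_sum: "tensor_at i (sum p A) = (\<Sum>x\<in>A. tensor_at i (p x))"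
  by (induction A rule: infinite_finite_induct) (simp_all add: tensor_at_add)

lemma tensor_at_mult_tensor: "tensor_at k p * tensor y = tensor (y(k := p * y k))"
  unfolding tensor_at_def tensor_mult by (rule arg_cong[of _ _ tensor]) auto

text \<open>Every pure tensor is a product of tensors with a single nontrivial factor, and these depend
  on that factor through an algebra homomorphism. This reduces expansions of pure tensors to
  expansions of products in a commutative ring.\<close>

lemma prod_tensor_at: "(\<Prod>i\<in>S. tensor_at i (f i)) = tensor (\<lambda>i. if i \<in> S then f i else 1)"
proof -
  have "finite S" by simp
  then show ?thesis
  proof (induction S rule: finite_induct)
    case (insert k S)
    then show ?case
      by (simp add: tensor_at_mult_tensor) (rule arg_cong[of _ _ tensor], auto)
  qed simp
qed

lemma tensor_eq_prod: "tensor f = (\<Prod>i\<in>UNIV. tensor_at i (f i))"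
  by (simp add: prod_tensor_at)

section \<open>Linear forms on the tensor power\<close>

definition multilinear_form :: "(('n::finite \<Rightarrow> 'a::comm_ring_1 poly) \<Rightarrow> 'a) \<Rightarrow> bool"
  where "multilinear_form \<Phi> \<longleftrightarrow>
    (\<forall>f i p q. \<Phi> (f(i := p + q)) = \<Phi> (f(i := p)) + \<Phi> (f(i := q))) \<and>
    (\<forall>f i a p. \<Phi> (f(i := Polynomial.smult a p)) = a * \<Phi> (f(i := p)))"

definition formal_form ::
    "(('n::finite \<Rightarrow> 'a::comm_ring_1 poly) \<Rightarrow> 'a) \<Rightarrow> (('n, 'a poly) symb \<Rightarrow>\<^sub>0 'a) \<Rightarrow> 'a"
  where "formal_form \<Phi> x =
    (\<Sum>k\<in>Poly_Mapping.keys x. Poly_Mapping.lookup x k * \<Phi> (factors k))"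

lemma formal_form_superset:
  assumes "finite S" "Poly_Mapping.keys x \<subseteq> S"
  shows "formal_form \<Phi> x = (\<Sum>k\<in>S. Poly_Mapping.lookup x k * \<Phi> (factors k))"
  unfolding formal_form_def using assms by (intro sum.mono_neutral_left) (auto simp: in_keys_iff)

lemma formal_form_add: "formal_form \<Phi> (x + y) = formal_form \<Phi> x + formal_form \<Phi> y"
proof -
  let ?S = "Poly_Mapping.keys x \<union> Poly_Mapping.keys y"
  have "Poly_Mapping.keys (x + y) \<subseteq> ?S"
    by (rule keys_add)
  then show ?thesis
    by (simp add: formal_form_superset[of ?S] lookup_add distrib_right sum.distrib)
qed

lemma formal_form_single: "formal_form \<Phi> (Poly_Mapping.single k c) = c * \<Phi> (factors k)"
  by (subst formal_form_superset[of "{k}"]) auto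

lemma formal_form_diff: "formal_form \<Phi> (x - y) = formal_form \<Phi> x - formal_form \<Phi> y"
  using formal_form_add[of \<Phi> "x - y" y] by simp

lemma formal_form_scalar: "formal_form \<Phi> (formal_scalar a * x) = a * formal_form \<Phi> x"
proof (induction x rule: formal_induct)
  case (single k v)
  then show ?case by (simp add: mult_single formal_form_single)
next
  case (sum x y)
  then show ?case by (simp add: distrib_left formal_form_add)
qed

lemma formal_form_relations:
  assumes "multilinear_form \<Phi>" and "x \<in> multilinear_relations"
  shows "formal_form \<Phi> x = 0"
  using assms(2)
proof (induction rule: multilinear_relations.induct)
  case (rel_add f i p q)
  show ?case
    using assms(1) by (simp add: multilinear_form_def formal_form_diff formal_form_single)
next
  case (rel_scale f i a p)
  show ?case
    using assms(1)
    by (simp add: multilinear_form_def formal_form_diff formal_form_scalar formal_form_single)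
next
  case rel_zero
  show ?case by (simp add: formal_form_def)
next
  case (rel_plus x y)
  then show ?case by (simp add: formal_form_add)
next
  case (rel_mult x a)
  then show ?case by (simp add: formal_form_scalar)
qed

text \<open>The universal property of the tensor power. The value on an arbitrary representative is
  taken, so that this is a total function of \<open>\<Phi>\<close>; it does not depend on the representative when
  \<open>\<Phi>\<close> is multilinear (\<open>tensor_form_abs\<close>).\<close>

definition tensor_form ::
    "(('n::finite \<Rightarrow> 'a::comm_ring_1 poly) \<Rightarrow> 'a) \<Rightarrow> ('a, 'n) tensor_power \<Rightarrow> 'a"
  where "tensor_form \<Phi> t = formal_form \<Phi> (rep_tensor_power t)"

lemma tensor_form_abs:
  assumes "multilinear_form \<Phi>"
  shows "tensor_form \<Phi> (abs_tensor_power x) = formal_form \<Phi> x"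
proof -
  have "tensor_cong (rep_tensor_power (abs_tensor_power x)) x"
    using Quotient3_tensor_power tensor_cong_refl by (rule Quotient3_rep_abs)
  then have "formal_form \<Phi> (rep_tensor_power (abs_tensor_power x) - x) = 0"
    unfolding tensor_cong_def by (rule formal_form_relations[OF assms])
  then show ?thesis
    by (simp add: tensor_form_def formal_form_diff)
qed

lemma tensor_form_add:
  assumes "multilinear_form \<Phi>"
  shows "tensor_form \<Phi> (s + t) = tensor_form \<Phi> s + tensor_form \<Phi> t"
  by (induction s rule: tensor_power.abs_induct, induction t rule: tensor_power.abs_induct)
    (simp add: plus_tensor_power.abs_eq tensor_form_abs[OF assms] formal_form_add)

lemma tensor_form_scalar:
  assumes "multilinear_form \<Phi>"
  shows "tensor_form \<Phi> (tensor_scalar a * t) = a * tensor_form \<Phi> t"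
  by (induction t rule: tensor_power.abs_induct)
    (simp add: tensor_scalar.abs_eq times_tensor_power.abs_eq tensor_form_abs[OF assms]
      formal_form_scalar)

lemma tensor_form_tensor:
  assumes "multilinear_form \<Phi>"
  shows "tensor_form \<Phi> (tensor f) = \<Phi> f"
  by (simp add: tensor.abs_eq tensor_form_abs[OF assms] formal_form_single)

lemma tensor_form_0:
  assumes "multilinear_form \<Phi>"
  shows "tensor_form \<Phi> 0 = 0"
  using tensor_form_scalar[OF assms, of 0 0] by simp

lemma tensor_form_uminus:
  assumes "multilinear_form \<Phi>"
  shows "tensor_form \<Phi> (- t) = - tensor_form \<Phi> t"
  using tensor_form_scalar[OF assms, of "-1" t] by (simp add: tensor_scalar_uminus)

lemma tensor_form_diff:
  assumes "multilinear_form \<Phi>"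
  shows "tensor_form \<Phi> (s - t) = tensor_form \<Phi> s - tensor_form \<Phi> t"
  using tensor_form_add[OF assms, of s "- t"] tensor_form_uminus[OF assms, of t] by simp

lemma tensor_form_sum:
  assumes "multilinear_form \<Phi>"
  shows "tensor_form \<Phi> (sum t A) = (\<Sum>x\<in>A. tensor_form \<Phi> (t x))"
  by (induction A rule: infinite_finite_induct)
    (simp_all add: tensor_form_0[OF assms] tensor_form_add[OF assms])

section \<open>Symmetric tensors form a subalgebra\<close>

lemma permute_tensor_add: "permute_tensor \<sigma> (s + t) = permute_tensor \<sigma> s + permute_tensor \<sigma> t"
  by transfer (simp add: map_key_plus[OF inj_permute_symb] tensor_cong_refl)

lemma permute_tensor_scalar:
  "permute_tensor \<sigma> (tensor_scalar a * t) = tensor_scalar a * permute_tensor \<sigma> t"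
  by transfer (simp only: permute_formal_scalar tensor_cong_refl)

lemma permute_tensor_1 [simp]: "permute_tensor \<sigma> 1 = 1"
  unfolding tensor_one[symmetric] permute_tensor_tensor by (simp add: comp_def del: tensor_one)

lemma permute_tensor_0 [simp]: "permute_tensor \<sigma> 0 = 0"
  using permute_tensor_scalar[of \<sigma> 0 0] by simp

lemma permute_tensor_sum: "permute_tensor \<sigma> (sum t A) = (\<Sum>x\<in>A. permute_tensor \<sigma> (t x))"
  by (induction A rule: infinite_finite_induct) (simp_all add: permute_tensor_add)

lemma permute_tensor_mult: "permute_tensor \<sigma> (s * t) = permute_tensor \<sigma> s * permute_tensor \<sigma> t"
proof (induction s rule: tensor_induct)
  case (scaled a f)
  show ?case
  proof (induction t rule: tensor_induct)
    case (scaled b g)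
    have "tensor_scalar a * tensor f * (tensor_scalar b * tensor g)
      = tensor_scalar a * (tensor_scalar b * tensor (\<lambda>i. f i * g i))"
      by (simp add: tensor_mult[symmetric] mult_ac)
    then show ?case
      by (simp add: permute_tensor_scalar permute_tensor_tensor)
        (simp add: tensor_mult[symmetric] comp_def mult_ac)
  next
    case (add s t)
    then show ?case by (simp add: distrib_left permute_tensor_add)
  qed
next
  case (add s t)
  then show ?case by (simp add: distrib_right permute_tensor_add)
qed

lemma symmetric_tensors_1: "1 \<in> symmetric_tensors"
  by (simp add: symmetric_tensors_def)

lemma symmetric_tensors_add:
  "s \<in> symmetric_tensors \<Longrightarrow> t \<in> symmetric_tensors \<Longrightarrow> s + t \<in> symmetric_tensors"
  by (simp add: symmetric_tensors_def permute_tensor_add)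

lemma symmetric_tensors_mult:
  "s \<in> symmetric_tensors \<Longrightarrow> t \<in> symmetric_tensors \<Longrightarrow> s * t \<in> symmetric_tensors"
  by (simp add: symmetric_tensors_def permute_tensor_mult)

lemma symmetric_tensors_scalar:
  "t \<in> symmetric_tensors \<Longrightarrow> tensor_scalar a * t \<in> symmetric_tensors"
  by (simp add: symmetric_tensors_def permute_tensor_scalar)

section \<open>Monomials and coefficients\<close>

definition tensor_monom :: "('n \<Rightarrow> nat) \<Rightarrow> ('a::comm_ring_1, 'n::finite) tensor_power"
  where "tensor_monom m = tensor (\<lambda>i. monom 1 (m i))"

lemma tensor_monom_mult: "tensor_monom a * tensor_monom b = tensor_monom (\<lambda>i. a i + b i)"
  by (simp add: tensor_monom_def tensor_mult mult_monom)

lemma tensor_monom_0: "tensor_monom (\<lambda>_. 0) = 1"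
  by (simp add: tensor_monom_def)

lemma permute_tensor_monom:
  "permute_tensor \<sigma> (tensor_monom m) = tensor_monom (m \<circ> Perm.apply (inverse \<sigma>))"
  by (simp add: tensor_monom_def permute_tensor_tensor comp_def)

lemma multilinear_form_prod_coeff: 
  "multilinear_form (\<lambda>f :: 'b::finite \<Rightarrow> 'c::comm_ring_1 poly. \<Prod>i\<in>UNIV. coeff (f i) (m i))"
  unfolding multilinear_form_def
proof (intro conjI allI)
  fix f :: "'b \<Rightarrow> 'c poly" and i p q a
  show "(\<Prod>j\<in>UNIV. coeff ((f(i := p + q)) j) (m j))
    = (\<Prod>j\<in>UNIV. coeff ((f(i := p)) j) (m j)) + (\<Prod>j\<in>UNIV. coeff ((f(i := q)) j) (m j))"
    by (simp add: prod.remove[of UNIV i] distrib_right)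
  show "(\<Prod>j\<in>UNIV. coeff ((f(i := Polynomial.smult a p)) j) (m j))
    = a * (\<Prod>j\<in>UNIV. coeff ((f(i := p)) j) (m j))"
    by (simp add: prod.remove[of UNIV i])
qed

text \<open>Coordinates with respect to the monomials. Their existence as linear forms is what makes the
  monomials linearly independent, and thus allows arguments on the support of a tensor.\<close>

definition tensor_coeff :: "('n \<Rightarrow> nat) \<Rightarrow> ('a::comm_ring_1, 'n::finite) tensor_power \<Rightarrow> 'a"
  where "tensor_coeff m = tensor_form (\<lambda>f. \<Prod>i\<in>UNIV. coeff (f i) (m i))"

lemmas tensor_coeff_add = tensor_form_add[OF multilinear_form_prod_coeff, folded tensor_coeff_def]
lemmas tensor_coeff_diff = tensor_form_diff[OF multilinear_form_prod_coeff, folded tensor_coeff_def]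
lemmas tensor_coeff_scalar = tensor_form_scalar[OF multilinear_form_prod_coeff, folded tensor_coeff_def]
lemmas tensor_coeff_sum = tensor_form_sum[OF multilinear_form_prod_coeff, folded tensor_coeff_def]
lemmas tensor_coeff_tensor = tensor_form_tensor[OF multilinear_form_prod_coeff, folded tensor_coeff_def]

lemma tensor_coeff_monom:
  "tensor_coeff m (tensor_monom a :: ('a::comm_ring_1, 'n::finite) tensor_power)
    = (if a = m then 1 else 0)"
proof (cases "a = m")
  case False
  then obtain i where "a i \<noteq> m i" by blast
  then have "(\<Prod>i\<in>UNIV. coeff (monom 1 (a i)) (m i)) = (0 :: 'a)"
    by (intro prod_zero) auto
  then show ?thesis using False by (simp add: tensor_monom_def tensor_coeff_tensor)
qed (simp add: tensor_monom_def tensor_coeff_tensor)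

lemma tensor_coeff_permute:
  "tensor_coeff m (permute_tensor \<sigma> t) = tensor_coeff (m \<circ> Perm.apply \<sigma>) t"
proof (induction t rule: tensor_induct)
  case (scaled a f)
  have "(\<Prod>i\<in>UNIV. coeff (f (Perm.apply (inverse \<sigma>) i)) (m i))
    = (\<Prod>j\<in>UNIV. coeff (f j) (m (Perm.apply \<sigma> j)))"
    by (rule prod.reindex_bij_witness[of _ "Perm.apply \<sigma>" "Perm.apply (inverse \<sigma>)"])
      (auto simp: apply_inverse_cancel)
  then show ?case
    by (simp add: permute_tensor_scalar permute_tensor_tensor tensor_coeff_scalar
        tensor_coeff_tensor)
qed (simp add: permute_tensor_add tensor_coeff_add)

lemma tensor_expand:
  "tensor f = (\<Sum>m\<in>Pi\<^sub>E UNIV (\<lambda>i. {..degree (f i)}).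
    tensor_scalar (\<Prod>i\<in>UNIV. coeff (f i) (m i)) * tensor_monom m)"
proof -
  have "tensor_at i (f i)
    = (\<Sum>d\<in>{..degree (f i)}. tensor_scalar (coeff (f i) d) * tensor_at i (monom 1 d))" for i
    by (subst (1) poly_as_sum_of_monoms[symmetric])
      (simp add: tensor_at_sum tensor_at_smult[symmetric] smult_monom)
  then have "tensor f = (\<Prod>i\<in>UNIV. \<Sum>d\<in>{..degree (f i)}.
      tensor_scalar (coeff (f i) d) * tensor_at i (monom 1 d))"
    by (simp only: tensor_eq_prod[of f])
  also have "\<dots> = (\<Sum>m\<in>Pi\<^sub>E UNIV (\<lambda>i. {..degree (f i)}).
      \<Prod>i\<in>UNIV. tensor_scalar (coeff (f i) (m i)) * tensor_at i (monom 1 (m i)))"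
    by (rule prod_sum_PiE) auto
  also have "\<dots> = (\<Sum>m\<in>Pi\<^sub>E UNIV (\<lambda>i. {..degree (f i)}).
      tensor_scalar (\<Prod>i\<in>UNIV. coeff (f i) (m i)) * tensor_monom m)"
    by (simp add: prod.distrib tensor_scalar_prod tensor_monom_def flip: tensor_eq_prod)
  finally show ?thesis .
qed

lemma tensor_finite_expansion:
  fixes t :: "('a::comm_ring_1, 'n::finite) tensor_power"
  shows "\<exists>S a. finite S \<and> t = (\<Sum>m\<in>S. tensor_scalar (a m) * tensor_monom m)"
proof (induction t rule: tensor_induct)
  case (scaled c f)
  let ?S = "Pi\<^sub>E UNIV (\<lambda>i. {..degree (f i)})"
  have "tensor_scalar c * tensor f
    = (\<Sum>m\<in>?S. tensor_scalar (c * (\<Prod>i\<in>UNIV. coeff (f i) (m i))) * tensor_monom m)"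
    by (subst tensor_expand) (simp add: sum_distrib_left tensor_scalar_mult mult.assoc)
  moreover have "finite ?S" by (intro finite_PiE) auto
  ultimately show ?case by (intro exI conjI)
next
  case (add s t)
  then obtain S a T b where fin: "finite S" "finite T"
    and s: "s = (\<Sum>m\<in>S. tensor_scalar (a m) * tensor_monom m)"
    and t: "t = (\<Sum>m\<in>T. tensor_scalar (b m) * tensor_monom m)"
    by blast
  let ?c = "\<lambda>m. (if m \<in> S then a m else 0) + (if m \<in> T then b m else 0)"
  have "s = (\<Sum>m\<in>S \<union> T. tensor_scalar (if m \<in> S then a m else 0) * tensor_monom m)"
    unfolding s using fin by (intro sum.mono_neutral_cong_left) auto
  moreover have "t = (\<Sum>m\<in>S \<union> T. tensor_scalar (if m \<in> T then b m else 0) * tensor_monom m)"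
    unfolding t using fin by (intro sum.mono_neutral_cong_left) auto
  ultimately have "s + t = (\<Sum>m\<in>S \<union> T. tensor_scalar (?c m) * tensor_monom m)"
    by (simp only: tensor_scalar_add distrib_right sum.distrib)
  with fin show ?case
    by (intro exI[of _ "S \<union> T"] exI[of _ ?c]) simp
qed

definition tensor_support :: "('a::comm_ring_1, 'n::finite) tensor_power \<Rightarrow> ('n \<Rightarrow> nat) set"
  where "tensor_support t = {m. tensor_coeff m t \<noteq> 0}"

text \<open>Applying the coordinate forms to any expression of \<open>t\<close> by finitely many monomials
  identifies its coefficients.\<close>

lemma
  shows finite_tensor_support: "finite (tensor_support t)"
    and tensor_support_expansion:
      "t = (\<Sum>m\<in>tensor_support t. tensor_scalar (tensor_coeff m t) * tensor_monom m)"
proof -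
  obtain S a where S: "finite S" and t: "t = (\<Sum>m\<in>S. tensor_scalar (a m) * tensor_monom m)"
    using tensor_finite_expansion by blast
  have c: "tensor_coeff m t = (if m \<in> S then a m else 0)" for m
    using S by (simp add: t tensor_coeff_sum tensor_coeff_scalar tensor_coeff_monom
        if_distrib[of "\<lambda>x. _ * x"] cong: if_cong)
  then have sub: "tensor_support t \<subseteq> S" by (auto simp: tensor_support_def split: if_splits)
  then show "finite (tensor_support t)" using S finite_subset by blast
  have "t = (\<Sum>m\<in>S. tensor_scalar (tensor_coeff m t) * tensor_monom m)"
    by (subst (1) t) (intro sum.cong refl, simp add: c)
  also have "\<dots> = (\<Sum>m\<in>tensor_support t. tensor_scalar (tensor_coeff m t) * tensor_monom m)"
    using S sub by (intro sum.mono_neutral_right) (auto simp: tensor_support_def)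
  finally show "t = (\<Sum>m\<in>tensor_support t. tensor_scalar (tensor_coeff m t) * tensor_monom m)" .
qed

section \<open>Orbits of exponents\<close>

text \<open>The orbit of an exponent under permutation of the factors is determined by the multiset of
  its entries, which serves as a name for the orbit.\<close>

definition shape :: "('n::finite \<Rightarrow> nat) \<Rightarrow> nat multiset"
  where "shape m = image_mset m (mset_set UNIV)"

lemma shape_comp_perm: "shape (m \<circ> Perm.apply \<sigma>) = shape m"
proof -
  have "image_mset (Perm.apply \<sigma>) (mset_set UNIV) = mset_set UNIV"
    by (simp add: image_mset_mset_set bij_is_inj bij_is_surj)
  then show ?thesis
    by (metis shape_def multiset.map_comp)
qed

lemma shape_eqE:
  assumes "shape m = shape l"
  obtains \<sigma> where "m = l \<circ> Perm.apply \<sigma>"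
proof -
  obtain p where p: "p permutes UNIV" "\<forall>x\<in>UNIV. m x = l (p x)"
    using image_mset_eq_implies_permutes[OF finite assms[unfolded shape_def]] by blast
  then have "Perm.apply (Perm p) = p"
    by (intro Perm_inverse) (simp add: permutes_bij)
  then have "m = l \<circ> Perm.apply (Perm p)" using p by auto
  then show ?thesis by (rule that)
qed

lemma symmetric_tensor_coeff_shape:
  assumes "t \<in> symmetric_tensors" "shape m = shape l"
  shows "tensor_coeff m t = tensor_coeff l t"
proof -
  obtain \<sigma> where "m = l \<circ> Perm.apply \<sigma>" using assms(2) by (rule shape_eqE)
  then show ?thesis
    using assms(1) tensor_coeff_permute[of l \<sigma> t] by (simp add: symmetric_tensors_def)
qed

lemma finite_shape: "finite {m. shape m = shape l}"
proof (rule finite_subset)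
  have "range m \<subseteq> range l" if "shape m = shape l" for m
  proof -
    have "set_mset (shape m) = set_mset (shape l)" using that by simp
    then show ?thesis by (simp add: shape_def)
  qed
  then show "{m. shape m = shape l} \<subseteq> Pi\<^sub>E UNIV (\<lambda>_. range l)" by auto
  show "finite (Pi\<^sub>E UNIV (\<lambda>_. range l) :: ('a \<Rightarrow> nat) set)" by (intro finite_PiE) auto
qed

definition orbit_sum :: "('n \<Rightarrow> nat) \<Rightarrow> ('a::comm_ring_1, 'n::finite) tensor_power"
  where "orbit_sum l = (\<Sum>m | shape m = shape l. tensor_monom m)"

lemma tensor_coeff_orbit_sum:
  "tensor_coeff m (orbit_sum l) = (if shape m = shape l then 1 else 0)"
  by (simp add: orbit_sum_def tensor_coeff_sum tensor_coeff_monom finite_shape)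

lemma comp_perm_cancel:
  "m \<circ> Perm.apply \<sigma> \<circ> Perm.apply (inverse \<sigma>) = m"
  "m \<circ> Perm.apply (inverse \<sigma>) \<circ> Perm.apply \<sigma> = m"
  by (auto simp: apply_inverse_cancel)

lemma orbit_sum_symmetric:
  "(orbit_sum l :: ('a::comm_ring_1, 'n::finite) tensor_power) \<in> symmetric_tensors"
proof -
  have "permute_tensor \<sigma> (orbit_sum l) = (orbit_sum l :: ('a, 'n) tensor_power)" for \<sigma>
    unfolding orbit_sum_def permute_tensor_sum permute_tensor_monom
    by (rule sum.reindex_bij_witness[of _ "\<lambda>m. m \<circ> Perm.apply \<sigma>"
          "\<lambda>m. m \<circ> Perm.apply (inverse \<sigma>)"])
      (simp_all add: comp_perm_cancel shape_comp_perm)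
  then show ?thesis by (simp add: symmetric_tensors_def)
qed

text \<open>Expanding \<open>\<Prod>\<^sub>i (T - f(X\<^sub>i))\<close> means choosing the set \<open>S\<close> of those factors from which
  \<open>- f(X\<^sub>i)\<close> is taken.\<close>

lemma sym_tensor_expand:
  assumes "k \<le> CARD('n)"
  shows "(sym_tensor k f :: ('a::comm_ring_1, 'n::finite) tensor_power)
    = (\<Sum>S | card S = k. tensor (\<lambda>i. if i \<in> S then f else 1))"
proof -
  let ?c = "\<lambda>S. tensor (\<lambda>i. if i \<in> S then f else 1) :: ('a, 'n) tensor_power"
  have "(\<Prod>i\<in>(UNIV :: 'n set). [:0, 1:] - [:tensor_at i f:])
    = (\<Prod>i\<in>UNIV. [:- tensor_at i f:] + [:0, 1:])"
    by (intro prod.cong) auto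
  also have "\<dots> = (\<Sum>S\<in>Pow UNIV. (\<Prod>i\<in>S. [:- tensor_at i f:]) * [:0, 1:] ^ card (UNIV - S))"
    by (subst prod_add) simp_all
  also have "\<dots> = (\<Sum>S\<in>Pow UNIV. monom ((- 1) ^ card S * ?c S) (CARD('n) - card S))"
  proof (intro sum.cong refl)
    fix S :: "'n set"
    have "(\<Prod>i\<in>S. [:- tensor_at i f:]) = [:\<Prod>i\<in>S. - tensor_at i f:]"
      by (induction S rule: infinite_finite_induct) auto
    then have "(\<Prod>i\<in>S. [:- tensor_at i f:]) = [:(- 1) ^ card S * ?c S:]"
      by (simp add: prod_uminus prod_tensor_at)
    moreover have "card (UNIV - S) = CARD('n) - card S"
      by (simp add: card_Diff_subset)
    ultimately show "(\<Prod>i\<in>S. [:- tensor_at i f:]) * [:0, 1:] ^ card (UNIV - S)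
      = monom ((- 1) ^ card S * ?c S) (CARD('n) - card S)"
      by (simp add: monom_altdef)
  qed
  finally have "(sym_tensor k f :: ('a, 'n) tensor_power) = (\<Sum>S\<in>UNIV.
      (- 1) ^ k * (if CARD('n) - card S = CARD('n) - k then (- 1) ^ card S * ?c S else 0))"
    by (simp add: sym_tensor_def coeff_sum sum_distrib_left)
  also have "\<dots> = (\<Sum>S\<in>UNIV. if card S = k then ?c S else 0)"
  proof (intro sum.cong refl)
    fix S :: "'n set"
    have "card S \<le> CARD('n)" by (rule card_mono) auto
    then have "CARD('n) - card S = CARD('n) - k \<longleftrightarrow> card S = k" using assms by auto
    moreover have "(- 1) ^ k * ((- 1) ^ k * x) = x" for x :: "('a, 'n) tensor_power"
      by (simp flip: mult.assoc power_mult_distrib)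
    ultimately show "(- 1) ^ k *
        (if CARD('n) - card S = CARD('n) - k then (- 1) ^ card S * ?c S else 0)
      = (if card S = k then ?c S else 0)" by auto
  qed
  finally show ?thesis by (simp add: sum.If_cases)
qed

lemma sym_tensor_symmetric:
  assumes "k \<le> CARD('n)"
  shows "(sym_tensor k f :: ('a::comm_ring_1, 'n::finite) tensor_power) \<in> symmetric_tensors"
proof -
  have "permute_tensor \<sigma> (sym_tensor k f) = (sym_tensor k f :: ('a, 'n) tensor_power)" for \<sigma>
    unfolding sym_tensor_expand[OF assms] permute_tensor_sum permute_tensor_tensor
  proof (rule sum.reindex_bij_witness[of _ "\<lambda>S. Perm.apply (inverse \<sigma>) ` S"
        "\<lambda>S. Perm.apply \<sigma> ` S"])
    fix S
    assume "S \<in> {S :: 'n set. card S = k}"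
    then show "Perm.apply \<sigma> ` S \<in> {S. card S = k}" "Perm.apply (inverse \<sigma>) ` S \<in> {S. card S = k}"
      by (auto simp: card_image bij_is_inj inj_on_subset[OF bij_is_inj])
    show "tensor (\<lambda>i. if i \<in> Perm.apply \<sigma> ` S then f else 1)
      = tensor ((\<lambda>i. if i \<in> S then f else 1) \<circ> Perm.apply (inverse \<sigma>))"
      by (rule arg_cong[of _ _ tensor]) (force simp: apply_inverse_cancel image_iff)
  qed (auto simp: image_image apply_inverse_cancel)
  then show ?thesis by (simp add: symmetric_tensors_def)
qed

section \<open>Generation by the elementary symmetric tensors\<close>

inductive_set elementary_algebra :: "('a::comm_ring_1, 'n::finite) tensor_power set"
  where
    elementary_one: "1 \<in> elementary_algebra"
  | elementary_gen: "k \<in> {1..CARD('n)} \<Longrightarrow>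
      (sym_tensor k [:0, 1:] :: ('a, 'n) tensor_power) \<in> elementary_algebra"
  | elementary_add: "s \<in> elementary_algebra \<Longrightarrow> t \<in> elementary_algebra \<Longrightarrow> s + t \<in> elementary_algebra"
  | elementary_mult: "s \<in> elementary_algebra \<Longrightarrow> t \<in> elementary_algebra \<Longrightarrow> s * t \<in> elementary_algebra"
  | elementary_scalar: "t \<in> elementary_algebra \<Longrightarrow> tensor_scalar a * t \<in> elementary_algebra"

lemma elementary_0: "0 \<in> elementary_algebra"
  using elementary_scalar[OF elementary_one, of 0] by simp

lemma elementary_diff:
  assumes "s \<in> elementary_algebra" "t \<in> elementary_algebra"
  shows "s - t \<in> elementary_algebra"
  using elementary_add[OF assms(1) elementary_scalar[OF assms(2), of "-1"]]
  by (simp add: tensor_scalar_uminus)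

lemma elementary_symmetric: "t \<in> elementary_algebra \<Longrightarrow> t \<in> symmetric_tensors"
  by (induction rule: elementary_algebra.induct)
    (auto intro: symmetric_tensors_1 sym_tensor_symmetric symmetric_tensors_add
      symmetric_tensors_mult symmetric_tensors_scalar)

text \<open>The coefficients of a symmetric tensor are constant on orbits, so subtracting a multiple of
  an orbit sum removes that orbit from the support and changes nothing else.\<close>

lemma elementary_if_orbit_sums:
  fixes t :: "('a::comm_ring_1, 'n::finite) tensor_power"
  assumes "t \<in> symmetric_tensors"
    and "\<And>l. l \<in> tensor_support t \<Longrightarrow> orbit_sum l \<in> (elementary_algebra :: ('a, 'n) tensor_power set)"
  shows "t \<in> elementary_algebra"
  using assms
proof (induction "card (tensor_support t)" arbitrary: t rule: less_induct)
  case less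
  show ?case
  proof (cases "tensor_support t = {}")
    case True
    then show ?thesis
      using tensor_support_expansion[of t] elementary_0 by simp
  next
    case False
    then obtain l where l: "l \<in> tensor_support t" by blast
    let ?c = "tensor_scalar (tensor_coeff l t) :: ('a, 'n) tensor_power"
    let ?t = "t - ?c * orbit_sum l"
    have coeff: "tensor_coeff m ?t = (if shape m = shape l then 0 else tensor_coeff m t)" for m
      using symmetric_tensor_coeff_shape[OF less.prems(1), of m l]
      by (simp add: tensor_coeff_diff tensor_coeff_scalar tensor_coeff_orbit_sum)
    have "t + tensor_scalar (- tensor_coeff l t) * orbit_sum l \<in> symmetric_tensors"
      using less.prems(1) orbit_sum_symmetric symmetric_tensors_add symmetric_tensors_scalar
      by blast
    then have sym: "?t \<in> symmetric_tensors" by (simp add: tensor_scalar_uminus)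
    have sub: "tensor_support ?t \<subseteq> tensor_support t - {l}"
      by (auto simp: tensor_support_def coeff split: if_splits)
    have "tensor_support ?t \<subset> tensor_support t"
      using sub l by blast
    with finite_tensor_support have "card (tensor_support ?t) < card (tensor_support t)"
      by (rule psubset_card_mono)
    then have "?t \<in> elementary_algebra"
    proof (rule less.hyps[OF _ sym])
      fix v assume "v \<in> tensor_support ?t"
      then have "v \<in> tensor_support t" using sub by blast
      then show "orbit_sum v \<in> (elementary_algebra :: ('a, 'n) tensor_power set)"
        by (rule less.prems(2))
    qed
    then have "?t + ?c * orbit_sum l \<in> elementary_algebra"
      using less.prems(2)[OF l] by (intro elementary_add elementary_scalar)
    then show ?thesis by simp
  qed
qed

lemma shape_imp_sum_eq:
  fixes m l :: "'n::finite \<Rightarrow> nat"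
  assumes "shape m = shape l"
  shows "(\<Sum>i\<in>UNIV. g (m i)) = (\<Sum>i\<in>UNIV. g (l i))"
proof -
  have *: "(\<Sum>i\<in>UNIV. g (m i)) = (\<Sum>x\<in>#shape m. g x)" for m :: "'n \<Rightarrow> nat"
    by (simp add: shape_def sum_unfold_sum_mset multiset.map_comp comp_def)
  show ?thesis by (simp only: * assms)
qed

abbreviation ind :: "'n set \<Rightarrow> 'n \<Rightarrow> nat"
  where "ind S \<equiv> \<lambda>i. if i \<in> S then 1 else 0"

text \<open>When \<open>S\<close> contains the support of \<open>m\<close>, adding \<open>1\<close> on \<open>S\<close> leaves exactly the zeros outside
  \<open>S\<close> untouched and raises all other entries. Hence the resulting orbit depends only on the orbit
  of \<open>m\<close> and on the size of \<open>S\<close>.\<close>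

lemma shape_add_ind:
  fixes m :: "'n::finite \<Rightarrow> nat"
  assumes "{i. m i \<noteq> 0} \<subseteq> S"
  shows "shape (\<lambda>i. ind S i + m i)
    = image_mset Suc (shape m - replicate_mset (CARD('n) - card S) 0)
      + replicate_mset (CARD('n) - card S) 0"
proof -
  have split: "mset_set UNIV = mset_set S + mset_set (- S)"
    by (subst mset_set_Union[symmetric]) auto
  have zero: "image_mset h (mset_set (- S)) = replicate_mset (CARD('n) - card S) 0"
    if "\<And>i. i \<notin> S \<Longrightarrow> h i = 0" for h :: "'n \<Rightarrow> nat"
  proof -
    have "image_mset h (mset_set (- S)) = image_mset (\<lambda>_. 0) (mset_set (- S))"
      using that by (intro image_mset_cong) auto
    then show ?thesis by (simp add: image_mset_const_eq Compl_eq_Diff_UNIV card_Diff_subset)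
  qed
  have "shape m = image_mset m (mset_set S) + replicate_mset (CARD('n) - card S) 0"
    unfolding shape_def split image_mset_union using assms by (subst zero) auto
  moreover have "shape (\<lambda>i. ind S i + m i)
    = image_mset Suc (image_mset m (mset_set S)) + replicate_mset (CARD('n) - card S) 0"
    unfolding shape_def split image_mset_union using assms
    by (subst zero) (auto simp: multiset.map_comp intro!: image_mset_cong)
  ultimately show ?thesis by simp
qed

lemma sum_squares_add_ind:
  fixes m :: "'n::finite \<Rightarrow> nat"
  shows "(\<Sum>i\<in>UNIV. (ind S i + m i)\<^sup>2) = card S + 2 * sum m S + (\<Sum>i\<in>UNIV. (m i)\<^sup>2)"
proof -
  have "(\<Sum>i\<in>UNIV. (ind S i + m i)\<^sup>2)
    = (\<Sum>i\<in>UNIV. (if i \<in> S then 1 + 2 * m i else 0) + (m i)\<^sup>2)"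
    by (intro sum.cong) (auto simp: power2_eq_square)
  also have "\<dots> = card S + 2 * sum m S + (\<Sum>i\<in>UNIV. (m i)\<^sup>2)"
    by (simp add: sum.distrib sum.If_cases sum_distrib_left sum_Suc)
  finally show ?thesis .
qed

lemma tensor_coeff_elementary_mult_orbit_sum:
  assumes "k \<le> CARD('n)"
  shows "tensor_coeff v ((sym_tensor k [:0, 1:] :: ('a::comm_ring_1, 'n::finite) tensor_power)
      * orbit_sum l)
    = of_nat (card {(S, m). card S = k \<and> shape m = shape l \<and> (\<lambda>i. ind S i + m i) = v})"
proof -
  let ?P = "{S :: 'n set. card S = k} \<times> {m. shape m = shape l}"
  have e: "(sym_tensor k [:0, 1:] :: ('a, 'n) tensor_power) = (\<Sum>S | card S = k. tensor_monom (ind S))"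
    unfolding sym_tensor_expand[OF assms] tensor_monom_def
    by (intro sum.cong refl arg_cong[of _ _ tensor]) (auto simp: monom_altdef)
  have fin: "finite ?P" using finite_shape by (intro finite_cartesian_product) auto
  have "tensor_coeff v ((sym_tensor k [:0, 1:] :: ('a, 'n) tensor_power) * orbit_sum l)
    = (\<Sum>(S, m)\<in>?P. if (\<lambda>i. ind S i + m i) = v then 1 else 0)"
    unfolding e orbit_sum_def sum_product sum.cartesian_product tensor_coeff_sum
    by (intro sum.cong refl) (auto simp: tensor_monom_mult tensor_coeff_monom)
  also have "\<dots> = of_nat (card {x \<in> ?P. case x of (S, m) \<Rightarrow> (\<lambda>i. ind S i + m i) = v})"
    using sum.inter_filter[OF fin, of "\<lambda>_. 1 :: 'a" "\<lambda>(S, m). (\<lambda>i. ind S i + m i) = v"]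
    by (simp add: case_prod_unfold)
  also have "{x \<in> ?P. case x of (S, m) \<Rightarrow> (\<lambda>i. ind S i + m i) = v}
    = {(S, m). card S = k \<and> shape m = shape l \<and> (\<lambda>i. ind S i + m i) = v}" by auto
  finally show ?thesis .
qed

text \<open>Subtracting \<open>1\<close> from the nonzero entries of \<open>l\<close> gives \<open>m\<^sub>0\<close>; let \<open>k\<close> be the number of these
  entries. The product of \<open>s\<^sub>k(X)\<close> with the orbit sum of \<open>m\<^sub>0\<close> consists of monomials with exponents
  \<open>v = ind S + m\<close>, where \<open>S\<close> has \<open>k\<close> elements and \<open>m\<close> is in the orbit of \<open>m\<^sub>0\<close>. They all have
  the same degree as \<open>l\<close>. The sum of the squares of the entries of \<open>v\<close> depends on \<open>S\<close> and \<open>m\<close>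
  only through the sum of \<open>m\<close> over \<open>S\<close>, so it is largest exactly when \<open>S\<close> contains the support of
  \<open>m\<close>, and then \<open>v\<close> is in the orbit of \<open>l\<close>. Since \<open>l\<close> itself arises only from its own
  support and \<open>m\<^sub>0\<close>, the product is the orbit sum of \<open>l\<close> plus orbit sums with the same degree and a
  smaller sum of squares, whereas \<open>m\<^sub>0\<close> has smaller degree. Unlike the usual argument with
  lexicographically leading terms, this one does not order the factors.\<close>

lemma orbit_sum_elementary:
  fixes l :: "'n::finite \<Rightarrow> nat"
  shows "orbit_sum l \<in> (elementary_algebra :: ('a::comm_ring_1, 'n) tensor_power set)"
proof (induction l rule: wf_induct_rule[OF wf_measures,
      of "[\<lambda>l. (\<Sum>i\<in>UNIV. l i), \<lambda>l. (\<Sum>i\<in>UNIV. (l i)\<^sup>2)]"])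
  case (1 l)
  define S0 where "S0 = {i. l i \<noteq> 0}"
  define m0 where "m0 = (\<lambda>i. l i - 1)"
  have l: "(\<lambda>i. ind S0 i + m0 i) = l"
    by (auto simp: S0_def m0_def)
  have m0: "{i. m0 i \<noteq> 0} \<subseteq> S0"
    by (auto simp: S0_def m0_def)
  show ?case
  proof (cases "S0 = {}")
    case True
    then have l0: "l = (\<lambda>_. 0)" by (auto simp: S0_def)
    have "{m. shape m = shape l} = {l}"
    proof -
      have "m = l" if "shape m = shape l" for m
        using that by (rule shape_eqE) (simp add: l0 comp_def)
      then show ?thesis by auto
    qed
    then show ?thesis
      by (simp add: orbit_sum_def l0 tensor_monom_0 elementary_one)
  next
    case False
    let ?k = "card S0"
    have k: "?k \<le> CARD('n)" by (rule card_mono) auto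
    have k1: "?k \<in> {1..CARD('n)}"
      using False k card_gt_0_iff[of S0] by (simp add: Suc_le_eq)
    have sum_l: "(\<Sum>i\<in>UNIV. l i) = ?k + (\<Sum>i\<in>UNIV. m0 i)"
      by (subst l[symmetric]) (simp add: sum.distrib sum.If_cases)
    have "(m0, l) \<in> measures [\<lambda>l. (\<Sum>i\<in>UNIV. l i), \<lambda>l. (\<Sum>i\<in>UNIV. (l i)\<^sup>2)]"
      using sum_l k1 by simp
    then have m0_alg: "orbit_sum m0 \<in> (elementary_algebra :: ('a, 'n) tensor_power set)"
      by (rule 1)
    let ?e = "sym_tensor ?k [:0, 1:] :: ('a, 'n) tensor_power"
    \<comment> \<open>The remainder: orbit sums of the same degree with a smaller sum of squares.\<close>
    let ?t = "?e * orbit_sum m0 - orbit_sum l"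
    have degree: "(\<Sum>i\<in>UNIV. ind S i + m i) = (\<Sum>i\<in>UNIV. l i)"
      if "card S = ?k" "shape m = shape m0" for S :: "'n set" and m
      using that sum_l shape_imp_sum_eq[OF that(2), of "\<lambda>x. x"]
      by (simp add: sum.distrib sum.If_cases)
    have squares: "(\<Sum>i\<in>UNIV. (ind S i + m i)\<^sup>2) < (\<Sum>i\<in>UNIV. (l i)\<^sup>2)"
      if "card S = ?k" "shape m = shape m0" "\<not> {i. m i \<noteq> 0} \<subseteq> S" for S :: "'n set" and m
    proof -
      have "sum m S < (\<Sum>i\<in>UNIV. m i)"
        using that(3) by (auto intro!: sum_strict_mono2)
      also have "\<dots> = (\<Sum>i\<in>UNIV. m0 i)"
        by (rule shape_imp_sum_eq[OF that(2), of "\<lambda>x. x"])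
      also have "\<dots> = sum m0 S0"
        using m0 by (intro sum.mono_neutral_right) auto
      finally have "card S + 2 * sum m S + (\<Sum>i\<in>UNIV. (m i)\<^sup>2)
        < card S0 + 2 * sum m0 S0 + (\<Sum>i\<in>UNIV. (m0 i)\<^sup>2)"
        using that(1) shape_imp_sum_eq[OF that(2), of "\<lambda>x. x\<^sup>2"] by simp
      then show ?thesis
        by (simp only: sum_squares_add_ind[symmetric] l[THEN fun_cong])
    qed
    have orbit: "shape (\<lambda>i. ind S i + m i) = shape l"
      if "card S = ?k" "shape m = shape m0" "{i. m i \<noteq> 0} \<subseteq> S" for S :: "'n set" and m
      using shape_add_ind[OF that(3)] shape_add_ind[OF m0] that(1,2) l by simp
    have "{(S, m). card S = ?k \<and> shape m = shape m0 \<and> (\<lambda>i. ind S i + m i) = l} = {(S0, m0)}"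
    proof -
      have "S = S0 \<and> m = m0"
        if *: "card S = ?k" "shape m = shape m0" "(\<lambda>i. ind S i + m i) = l" for S m
      proof -
        have li: "ind S i + m i = l i" for i using *(3) by metis
        have sub: "{i. m i \<noteq> 0} \<subseteq> S"
          using squares[OF *(1,2)] li by auto
        have "S = S0"
          using sub by (auto simp: S0_def simp flip: li split: if_splits)
        moreover have "m = m0"
        proof
          fix i
          have "m i = 0" if "i \<notin> S" using sub that by auto
          then show "m i = m0 i" using li[of i] by (cases "i \<in> S") (simp_all add: m0_def)
        qed
        ultimately show ?thesis by simp
      qed
      then show ?thesis using l by auto
    qed
    then have coeff_l: "tensor_coeff l (?e * orbit_sum m0) = 1"
      by (simp add: tensor_coeff_elementary_mult_orbit_sum[OF k])
    have e_sym: "?e * orbit_sum m0 \<in> symmetric_tensors"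
      by (intro symmetric_tensors_mult sym_tensor_symmetric k orbit_sum_symmetric)
    have "?e * orbit_sum m0 + tensor_scalar (- 1) * orbit_sum l \<in> symmetric_tensors"
      using e_sym orbit_sum_symmetric symmetric_tensors_add symmetric_tensors_scalar by blast
    then have "?t \<in> symmetric_tensors"
      by (simp add: tensor_scalar_uminus)
    moreover have "orbit_sum v \<in> (elementary_algebra :: ('a, 'n) tensor_power set)"
      if v: "v \<in> tensor_support ?t" for v
    proof (rule 1)
      have ne: "shape v \<noteq> shape l"
      proof
        assume vl: "shape v = shape l"
        then have "tensor_coeff v ?t = 0"
          using symmetric_tensor_coeff_shape[OF e_sym vl] coeff_l
          by (simp add: tensor_coeff_diff tensor_coeff_orbit_sum)
        then show False using v by (simp add: tensor_support_def)
      qed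
      then have "tensor_coeff v (?e * orbit_sum m0) \<noteq> 0"
        using v by (simp add: tensor_support_def tensor_coeff_diff tensor_coeff_orbit_sum)
      then have "card {(S, m). card S = ?k \<and> shape m = shape m0 \<and> (\<lambda>i. ind S i + m i) = v} \<noteq> 0"
        unfolding tensor_coeff_elementary_mult_orbit_sum[OF k] by (metis of_nat_0)
      then have "{(S, m). card S = ?k \<and> shape m = shape m0 \<and> (\<lambda>i. ind S i + m i) = v} \<noteq> {}"
        by (metis card.empty)
      then obtain S m where *: "card S = ?k" "shape m = shape m0"
        and vS: "v = (\<lambda>i. ind S i + m i)" by auto
      have "\<not> {i. m i \<noteq> 0} \<subseteq> S" using orbit[OF *] ne vS by auto
      then show "(v, l) \<in> measures [\<lambda>l. (\<Sum>i\<in>UNIV. l i), \<lambda>l. (\<Sum>i\<in>UNIV. (l i)\<^sup>2)]"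
        using squares[OF *] degree[OF *] by (simp add: vS)
    qed
    ultimately have "?t \<in> elementary_algebra"
      by (rule elementary_if_orbit_sums)
    moreover have "?e * orbit_sum m0 \<in> elementary_algebra"
      using k1 m0_alg by (intro elementary_mult elementary_gen)
    ultimately have "?e * orbit_sum m0 - ?t \<in> elementary_algebra"
      using elementary_diff by blast
    then show ?thesis by simp
  qed
qed

text \<open>The fundamental theorem on symmetric polynomials, without the algebraic independence of the
  generators.\<close>

theorem symmetric_tensors_eq_elementary_algebra:
  "symmetric_tensors = (elementary_algebra :: ('a::comm_ring_1, 'n::finite) tensor_power set)"
  using elementary_if_orbit_sums orbit_sum_elementary elementary_symmetric by blast

section \<open>Bases modulo a polynomial\<close>

text \<open>The residue classes of \<open>b 0, \<dots>, b (m - 1)\<close> form a basis of the polynomials modulo \<open>F\<close>, and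
  \<open>coord\<close> takes coordinates in it. Working with representatives keeps all computations in the
  polynomial ring.\<close>

locale basis_mod =
  fixes F :: "'a::comm_ring_1 poly"
    and b :: "nat \<Rightarrow> 'a poly"
    and coord :: "'a poly \<Rightarrow> nat \<Rightarrow> 'a"
    and m :: nat
  assumes expand: "F dvd p - (\<Sum>i<m. Polynomial.smult (coord p i) (b i))"
    and indep: "F dvd (\<Sum>i<m. Polynomial.smult (c i) (b i)) \<Longrightarrow> i < m \<Longrightarrow> c i = 0"
begin

lemma coord_unique:
  assumes "F dvd p - (\<Sum>i<m. Polynomial.smult (c i) (b i))" "i < m"
  shows "coord p i = c i"
proof -
  have "(\<Sum>i<m. Polynomial.smult (coord p i - c i) (b i))
    = (p - (\<Sum>i<m. Polynomial.smult (c i) (b i))) - (p - (\<Sum>i<m. Polynomial.smult (coord p i) (b i)))"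
    by (simp add: smult_diff_left sum_subtractf)
  also have "F dvd \<dots>" using assms(1) expand by (rule dvd_diff)
  finally have "coord p i - c i = 0"
    using assms(2) by (rule indep[of "\<lambda>i. coord p i - c i"])
  then show ?thesis by simp
qed

lemma coord_add: "i < m \<Longrightarrow> coord (p + q) i = coord p i + coord q i"
proof (rule coord_unique)
  show "F dvd (p + q) - (\<Sum>i<m. Polynomial.smult (coord p i + coord q i) (b i))"
    using dvd_add[OF expand[of p] expand[of q]]
    by (simp add: smult_add_left sum.distrib algebra_simps)
qed

lemma coord_smult: "i < m \<Longrightarrow> coord (Polynomial.smult a p) i = a * coord p i"
proof (rule coord_unique)
  have "F dvd Polynomial.smult a (p - (\<Sum>i<m. Polynomial.smult (coord p i) (b i)))"
    using expand by (rule dvd_smult)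
  then show "F dvd Polynomial.smult a p - (\<Sum>i<m. Polynomial.smult (a * coord p i) (b i))"
    by (simp add: smult_diff_right smult_sum2)
qed

lemma coord_basis:
  assumes "j < m" "i < m"
  shows "coord (b j) i = (if i = j then 1 else 0)"
proof (rule coord_unique)
  have "(\<Sum>i<m. Polynomial.smult (if i = j then 1 else 0) (b i)) = b j"
    using assms(1) by (subst sum.remove[of _ j]) auto
  then show "F dvd b j - (\<Sum>i<m. Polynomial.smult (if i = j then 1 else 0) (b i))" by simp
qed (rule assms)

definition mult_mat :: "'a poly \<Rightarrow> 'a mat"
  where "mult_mat f = mat m m (\<lambda>(i, j). coord (f * b j) i)"

lemma mult_mat_carrier [simp]: "mult_mat f \<in> carrier_mat m m"
  by (simp add: mult_mat_def)

lemma coord_mult: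
  assumes "i < m"
  shows "coord (f * p) i = (\<Sum>j<m. mult_mat f $$ (i, j) * coord p j)"
proof -
  have "coord (f * p) i = (\<Sum>j<m. coord (f * b j) i * coord p j)"
  proof (rule coord_unique[OF _ assms])
    have "(\<Sum>i<m. Polynomial.smult (\<Sum>j<m. coord (f * b j) i * coord p j) (b i))
      = (\<Sum>j<m. \<Sum>i<m. Polynomial.smult (coord p j) (Polynomial.smult (coord (f * b j) i) (b i)))"
      by (subst sum.swap) (simp add: smult_sum mult.commute)
    also have "\<dots> = (\<Sum>j<m. Polynomial.smult (coord p j)
        (\<Sum>i<m. Polynomial.smult (coord (f * b j) i) (b i)))"
      by (simp add: smult_sum2)
    finally have "f * p - (\<Sum>i<m. Polynomial.smult (\<Sum>j<m. coord (f * b j) i * coord p j) (b i))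
      = f * (p - (\<Sum>j<m. Polynomial.smult (coord p j) (b j)))
        + (\<Sum>j<m. Polynomial.smult (coord p j)
            (f * b j - (\<Sum>i<m. Polynomial.smult (coord (f * b j) i) (b i))))"
      by (simp add: smult_diff_right sum_subtractf right_diff_distrib sum_distrib_left)
    also have "F dvd \<dots>"
      by (intro dvd_add dvd_mult dvd_sum dvd_smult expand)
    finally show "F dvd f * p - (\<Sum>i<m. Polynomial.smult (\<Sum>j<m. coord (f * b j) i * coord p j) (b i))" .
  qed
  also have "\<dots> = (\<Sum>j<m. mult_mat f $$ (i, j) * coord p j)"
    using assms by (simp add: mult_mat_def)
  finally show ?thesis .
qed

text \<open>Let \<open>M\<close> be the matrix of multiplication by \<open>X\<close>. The row vector \<open>(b\<^sub>i)\<close> times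
  \<open>X 1 - M\<close> vanishes modulo \<open>F\<close>, where the indeterminate of the characteristic polynomial is
  identified with the \<open>X\<close> of the polynomial ring. Multiplying by the adjugate matrix
  shows that \<open>\<chi>\<^sub>X b\<^sub>k\<close> vanishes modulo \<open>F\<close> for all \<open>k\<close>. As \<open>1\<close> is a combination of the
  \<open>b\<^sub>k\<close>, so does \<open>\<chi>\<^sub>X\<close>.\<close>

lemma dvd_char_poly_mult_X: "F dvd char_poly (mult_mat [:0, 1:])"
proof -
  let ?M = "mult_mat [:0, 1:]"
  let ?C = "char_poly_matrix ?M"
  let ?A = "adj_mat ?C"
  have C: "?C \<in> carrier_mat m m" by simp
  note A = adj_mat[OF C]
  have C_dvd: "F dvd (\<Sum>i<m. b i * ?C $$ (i, j))" if j: "j < m" for j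
  proof -
    have "(\<Sum>i<m. b i * ?C $$ (i, j))
      = (\<Sum>i<m. (if i = j then [:0, 1:] * b i else 0)
          - Polynomial.smult (coord ([:0, 1:] * b j) i) (b i))"
    proof (intro sum.cong refl)
      fix i assume "i \<in> {..<m}"
      then have "?C $$ (i, j)
        = (if i = j then [:0, 1:] else 0) - [:coord ([:0, 1:] * b j) i:]"
        using j by (simp add: char_poly_matrix_def mult_mat_def)
      then show "b i * ?C $$ (i, j) = (if i = j then [:0, 1:] * b i else 0)
          - Polynomial.smult (coord ([:0, 1:] * b j) i) (b i)"
        by (simp add: right_diff_distrib)
    qed
    also have "\<dots> = [:0, 1:] * b j - (\<Sum>i<m. Polynomial.smult (coord ([:0, 1:] * b j) i) (b i))"
      using j by (simp add: sum_subtractf)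
    also have "F dvd \<dots>" by (rule expand)
    finally show ?thesis .
  qed
  have b_dvd: "F dvd char_poly ?M * b k" if k: "k < m" for k
  proof -
    have "(\<Sum>j<m. (\<Sum>i<m. b i * ?C $$ (i, j)) * ?A $$ (j, k))
      = (\<Sum>i<m. b i * (\<Sum>j<m. ?C $$ (i, j) * ?A $$ (j, k)))"
      by (simp add: sum_distrib_right sum_distrib_left mult.assoc) (rule sum.swap)
    also have "\<dots> = (\<Sum>i<m. b i * (?C * ?A) $$ (i, k))"
      using k carrier_matD[OF C] carrier_matD[OF A(1)] by (intro sum.cong refl)
        (auto simp: scalar_prod_def atLeast0LessThan)
    also have "\<dots> = (\<Sum>i<m. if i = k then char_poly ?M * b i else 0)"
      unfolding A(2) using k by (intro sum.cong refl) (auto simp: char_poly_def)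
    also have "\<dots> = char_poly ?M * b k" using k by simp
    finally show ?thesis
      using C_dvd by (metis (no_types, lifting) dvd_mult2 dvd_sum lessThan_iff)
  qed
  have "char_poly ?M
    = char_poly ?M * (1 - (\<Sum>i<m. Polynomial.smult (coord 1 i) (b i)))
      + (\<Sum>i<m. Polynomial.smult (coord 1 i) (char_poly ?M * b i))"
    by (simp add: right_diff_distrib sum_distrib_left)
  also have "F dvd \<dots>"
    by (intro dvd_add[OF dvd_mult[OF expand]] dvd_sum dvd_smult b_dvd) simp
  finally show ?thesis .
qed

end

text \<open>A basis with more elements than another one would give square matrices \<open>P\<close> and \<open>Q\<close> with
  \<open>P Q = 1\<close>, padded by zeros, although \<open>Q\<close> has a zero row. Over an arbitrary nonzero
  commutative ring this contradicts the multiplicativity of the determinant.\<close>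

lemma basis_mod_card_le:
  assumes "basis_mod F b coord m" "basis_mod F b' coord' n"
  shows "m \<le> n"
proof (rule ccontr)
  assume "\<not> m \<le> n"
  then have nm: "n < m" by simp
  interpret B: basis_mod F b coord m by fact
  interpret B': basis_mod F b' coord' n by fact
  define P where "P = mat m m (\<lambda>(i, j). if j < n then coord (b' j) i else 0)"
  define Q where "Q = mat m m (\<lambda>(i, j). if i < n then coord' (b j) i else 0)"
  have PQ: "P \<in> carrier_mat m m" "Q \<in> carrier_mat m m" by (simp_all add: P_def Q_def)
  have "P * Q = 1\<^sub>m m"
  proof (rule eq_matI)
    fix i k
    assume "i < dim_row (1\<^sub>m m :: 'a mat)" "k < dim_col (1\<^sub>m m :: 'a mat)"
    then have ik: "i < m" "k < m" by auto
    have "coord (b k) i = (\<Sum>j<n. coord (b' j) i * coord' (b k) j)"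
    proof (rule B.coord_unique)
      have "(\<Sum>i<m. Polynomial.smult (\<Sum>j<n. coord (b' j) i * coord' (b k) j) (b i))
        = (\<Sum>j<n. \<Sum>i<m. Polynomial.smult (coord' (b k) j) (Polynomial.smult (coord (b' j) i) (b i)))"
        by (subst sum.swap) (simp add: smult_sum mult.commute)
      also have "\<dots> = (\<Sum>j<n. Polynomial.smult (coord' (b k) j)
          (\<Sum>i<m. Polynomial.smult (coord (b' j) i) (b i)))"
        by (simp add: smult_sum2)
      finally have "b k - (\<Sum>i<m. Polynomial.smult (\<Sum>j<n. coord (b' j) i * coord' (b k) j) (b i))
        = (b k - (\<Sum>j<n. Polynomial.smult (coord' (b k) j) (b' j)))
          + (\<Sum>j<n. Polynomial.smult (coord' (b k) j)
              (b' j - (\<Sum>i<m. Polynomial.smult (coord (b' j) i) (b i))))"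
        by (simp add: smult_diff_right sum_subtractf)
      also have "F dvd \<dots>"
        by (intro dvd_add dvd_sum dvd_smult B.expand B'.expand)
      finally show "F dvd b k
        - (\<Sum>i<m. Polynomial.smult (\<Sum>j<n. coord (b' j) i * coord' (b k) j) (b i))" .
    qed (rule ik)
    moreover have "(P * Q) $$ (i, k)
      = (\<Sum>j<m. if j < n then coord (b' j) i * coord' (b k) j else 0)"
      using ik by (auto simp: P_def Q_def scalar_prod_def atLeast0LessThan intro!: sum.cong)
    moreover have "{..<m} \<inter> {j. j < n} = {..<n}" using nm by auto
    ultimately have "(P * Q) $$ (i, k) = coord (b k) i"
      by (simp add: sum.If_cases)
    then show "(P * Q) $$ (i, k) = 1\<^sub>m m $$ (i, k)"
      using ik B.coord_basis by simp
  qed (simp_all add: P_def Q_def)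
  \<comment> \<open>Row \<open>n\<close> of \<open>Q\<close> is zero.\<close>
  moreover have "det Q = 0"
    unfolding det_def'[OF PQ(2)]
  proof (rule sum.neutral, safe)
    fix p assume "p permutes {0..<m}"
    then have "p n < m" using nm permutes_in_image[of p "{0..<m}" n] by auto
    then have "(\<Prod>i = 0..<m. Q $$ (i, p i)) = 0"
      using nm by (intro prod_zero) (auto simp: Q_def intro!: bexI[of _ n])
    then show "signof p * (\<Prod>i = 0..<m. Q $$ (i, p i)) = 0" by simp
  qed
  ultimately show False
    using det_mult[OF PQ] by simp
qed

lemma monic_dvd_degree_less_imp_0:
  assumes "monic F" "F dvd r" "degree r < degree F"
  shows "r = 0"
proof -
  obtain q where q: "r = F * q" using assms(2) by blast
  have "coeff r (degree F + degree q) = coeff q (degree q)"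
    unfolding q coeff_mult_degree_sum by (simp add: assms(1))
  moreover have "coeff r (degree F + degree q) = 0"
    using assms(3) by (intro coeff_eq_0) simp
  ultimately have "q = 0" by simp
  then show ?thesis using q by simp
qed

lemma basis_mod_monom:
  assumes "monic F" "0 < degree F"
  obtains coord where "basis_mod F (monom 1) coord (degree F)"
proof -
  have "\<exists>c. F dvd p - (\<Sum>i<degree F. Polynomial.smult (c i) (monom 1 i))" for p
  proof -
    obtain q r where qr: "pseudo_divmod p F = (q, r)" by fastforce
    have F0: "F \<noteq> 0" using assms(2) by auto
    have pqr: "p = F * q + r" and deg: "r = 0 \<or> degree r < degree F"
      using pseudo_divmod[OF F0 qr] assms(1) by auto
    have "r = (\<Sum>i<degree F. Polynomial.smult (coeff r i) (monom 1 i))"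
    proof (rule poly_eqI)
      fix k
      have "coeff r k = 0" if "\<not> k < degree F"
        using deg that by (auto intro: coeff_eq_0)
      then show "coeff r k = coeff (\<Sum>i<degree F. Polynomial.smult (coeff r i) (monom 1 i)) k"
        by (auto simp: coeff_sum smult_monom)
    qed
    then have "p - (\<Sum>i<degree F. Polynomial.smult (coeff r i) (monom 1 i)) = F * q"
      using pqr by simp
    then show ?thesis by (metis dvd_triv_left)
  qed
  then obtain coord where
    c: "F dvd p - (\<Sum>i<degree F. Polynomial.smult (coord p i) (monom 1 i))" for p
    by metis
  have "basis_mod F (monom 1) coord (degree F)"
  proof
    fix c :: "nat \<Rightarrow> 'a" and i
    assume dvd: "F dvd (\<Sum>i<degree F. Polynomial.smult (c i) (monom 1 i))" and i: "i < degree F"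
    have "degree (\<Sum>i<degree F. Polynomial.smult (c i) (monom 1 i)) < degree F"
      using assms(2)
      by (intro degree_sum_less le_less_trans[OF degree_smult_le] le_less_trans[OF degree_monom_le])
        auto
    then have "(\<Sum>i<degree F. Polynomial.smult (c i) (monom 1 i)) = 0"
      using assms(1) dvd by (intro monic_dvd_degree_less_imp_0[of F])
    then have "coeff (\<Sum>i<degree F. Polynomial.smult (c i) (monom 1 i)) i = 0" by simp
    then show "c i = 0" using i by (simp add: coeff_sum smult_monom)
  qed (rule c)
  then show ?thesis by (rule that)
qed

lemma (in basis_mod) card_basis_eq_degree:
  assumes "monic F" "0 < degree F"
  shows "m = degree F"
proof -
  obtain coord' where B: "basis_mod F (monom 1) coord' (degree F)"
    using basis_mod_monom[OF assms] .
  show ?thesis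
    using basis_mod_card_le[OF basis_mod_axioms B] basis_mod_card_le[OF B basis_mod_axioms]
    by simp
qed

lemma (in basis_mod) char_poly_mult_X:
  assumes "monic F" "0 < degree F"
  shows "char_poly (mult_mat [:0, 1:]) = F"
proof -
  let ?\<chi> = "char_poly (mult_mat [:0, 1:])"
  have deg: "degree ?\<chi> = degree F" and lead: "coeff ?\<chi> (degree F) = 1"
    using degree_monic_char_poly[OF mult_mat_carrier, of "[:0, 1:]"] card_basis_eq_degree[OF assms]
    by auto
  have "degree (?\<chi> - F) < degree F"
  proof (rule degree_lessI)
    show "\<forall>k\<ge>degree F. coeff (?\<chi> - F) k = 0"
      using deg lead assms(1) by (auto simp: le_less coeff_eq_0)
  qed (use assms in auto)
  moreover have "F dvd ?\<chi> - F"
    using dvd_char_poly_mult_X by simp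
  ultimately have "?\<chi> - F = 0"
    using assms(1) by (intro monic_dvd_degree_less_imp_0[of F])
  then show ?thesis by simp
qed

section \<open>Determinants with rows indexed by the tensor factors\<close>

text \<open>An arbitrary numbering of the tensor factors, which is needed because the rows of matrices
  are numbered. The choice affects determinants only by a sign, which cancels since the basis
  tensor is formed with the same numbering.\<close>

definition nth_factor :: "nat \<Rightarrow> 'n::finite"
  where "nth_factor = (SOME e. bij_betw e {0..<CARD('n)} (UNIV :: 'n set))"

lemma bij_betw_nth_factor: "bij_betw (nth_factor :: nat \<Rightarrow> 'n::finite) {0..<CARD('n)} UNIV"
  unfolding nth_factor_def by (rule someI_ex[OF ex_bij_betw_nat_finite[OF finite]])

definition factor_index :: "'n::finite \<Rightarrow> nat"
  where "factor_index = inv_into {0..<CARD('n)} nth_factor"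

lemma factor_index_nth_factor [simp]: "i < CARD('n) \<Longrightarrow> factor_index (nth_factor i :: 'n::finite) = i"
  unfolding factor_index_def using bij_betw_inv_into_left[OF bij_betw_nth_factor[where 'n = 'n]] by simp

lemma nth_factor_index [simp]: "nth_factor (factor_index k) = k"
  unfolding factor_index_def using bij_betw_inv_into_right[OF bij_betw_nth_factor] by simp

lemma factor_index_less [simp]: "factor_index (k :: 'n::finite) < CARD('n)"
proof -
  have "k \<in> nth_factor ` {0..<CARD('n)}" using bij_betw_nth_factor[where 'n = 'n] by (simp add: bij_betw_def)
  then show ?thesis by auto
qed

text \<open>Indexing the rows by the tensor factors makes the multilinearity of the determinant directly
  one in the factors.\<close>

definition rows_det :: "('n::finite \<Rightarrow> nat \<Rightarrow> 'b::comm_ring_1) \<Rightarrow> 'b"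
  where "rows_det G = det (mat CARD('n) CARD('n) (\<lambda>(i, j). G (nth_factor i) j))"

lemma rows_det_Leibniz:
  fixes G :: "'n::finite \<Rightarrow> nat \<Rightarrow> 'b::comm_ring_1"
  shows "rows_det G
    = (\<Sum>p | p permutes {0..<CARD('n)}. signof p * (\<Prod>k\<in>UNIV. G k (p (factor_index k))))"
proof -
  let ?M = "mat CARD('n) CARD('n) (\<lambda>(i, j). G (nth_factor i) j)"
  have "(\<Prod>i = 0..<CARD('n). ?M $$ (i, p i)) = (\<Prod>k\<in>UNIV. G k (p (factor_index k)))"
    if p: "p permutes {0..<CARD('n)}" for p
  proof (rule prod.reindex_bij_witness[of _ factor_index nth_factor])
    fix i assume "i \<in> {0..<CARD('n)}"
    then show "G (nth_factor i) (p (factor_index (nth_factor i :: 'n))) = ?M $$ (i, p i)"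
      using permutes_in_image[OF p, of i] by simp
  qed auto
  then show ?thesis
    unfolding rows_det_def by (subst det_def'[of _ "CARD('n)"]) auto
qed

lemma rows_det_linear:
  "rows_det (G(k := \<lambda>j. a * g j + c * h j)) = a * rows_det (G(k := g)) + c * rows_det (G(k := h))"
  unfolding rows_det_Leibniz
  by (simp add: prod.remove[of UNIV k] sum_distrib_left distrib_left distrib_right sum.distrib
      mult_ac)

lemma rows_det_cong:
  fixes G H :: "'n::finite \<Rightarrow> nat \<Rightarrow> 'b::comm_ring_1"
  assumes "\<And>k j. j < CARD('n) \<Longrightarrow> G k j = H k j"
  shows "rows_det G = rows_det H"
  unfolding rows_det_def by (rule arg_cong[of _ _ det]) (auto intro!: eq_matI simp: assms)

lemma rows_det_const:
  fixes G :: "'n::finite \<Rightarrow> nat \<Rightarrow> 'b::comm_ring_1"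
  shows "rows_det (\<lambda>k j. [:G k j:]) = [:rows_det G:]"
proof -
  interpret comm_ring_hom "\<lambda>x :: 'b. [:x:]"
    by unfold_locales (auto simp: one_pCons)
  show ?thesis
    unfolding rows_det_def hom_det[symmetric] by (rule arg_cong[of _ _ det]) auto
qed

section \<open>The determinant form and the characteristic polynomial\<close>

text \<open>The conditions defining \<open>u\<^sub>F\<close> fix it on generators of the algebra of symmetric tensors,
  hence everywhere.\<close>

lemma sym_alg_hom_unique:
  fixes t :: "('a::comm_ring_1, 'n::finite) tensor_power"
  assumes u: "is_sym_alg_hom u" and v: "is_sym_alg_hom v"
    and agree: "\<And>i. i \<in> {1..CARD('n)} \<Longrightarrow> u (sym_tensor i [:0, 1:]) = v (sym_tensor i [:0, 1:])"
    and t: "t \<in> symmetric_tensors"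
  shows "u t = v t"
  using t unfolding symmetric_tensors_eq_elementary_algebra
proof (induction rule: elementary_algebra.induct)
  case elementary_one
  then show ?case using u v by (simp add: is_sym_alg_hom_def)
next
  case (elementary_gen k)
  then show ?case by (rule agree)
next
  case (elementary_add r s)
  then show ?case
    using u v elementary_symmetric[of r] elementary_symmetric[of s]
    by (simp add: is_sym_alg_hom_def)
next
  case (elementary_mult r s)
  then show ?case
    using u v elementary_symmetric[of r] elementary_symmetric[of s]
    by (simp add: is_sym_alg_hom_def)
next
  case (elementary_scalar s a)
  then show ?case
    using u v elementary_symmetric[of s] by (simp add: is_sym_alg_hom_def)
qed

context basis_mod
begin

text \<open>The form \<open>D\<close>, before its extension to the tensor power.\<close>

definition det_form :: "('n::finite \<Rightarrow> 'a poly) \<Rightarrow> 'a"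
  where "det_form y = rows_det (\<lambda>k. coord (y k))"

lemma multilinear_form_det_form:
  assumes "m = CARD('n::finite)"
  shows "multilinear_form (det_form :: ('n \<Rightarrow> 'a poly) \<Rightarrow> 'a)"
  unfolding multilinear_form_def
proof (intro conjI allI)
  fix f :: "'n \<Rightarrow> 'a poly" and i p q a
  have upd: "det_form (f(i := r)) = rows_det ((\<lambda>k. coord (f k))(i := coord r))" for r
    unfolding det_form_def by (rule rows_det_cong) auto
  have "det_form (f(i := p + q))
    = rows_det ((\<lambda>k. coord (f k))(i := \<lambda>j. 1 * coord p j + 1 * coord q j))"
    unfolding upd by (rule rows_det_cong) (auto simp: coord_add assms)
  then show "det_form (f(i := p + q)) = det_form (f(i := p)) + det_form (f(i := q))"
    unfolding rows_det_linear by (simp add: upd)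
  have "det_form (f(i := Polynomial.smult a p))
    = rows_det ((\<lambda>k. coord (f k))(i := \<lambda>j. a * coord p j + 0 * coord p j))"
    unfolding upd by (rule rows_det_cong) (auto simp: coord_smult assms)
  then show "det_form (f(i := Polynomial.smult a p)) = a * det_form (f(i := p))"
    unfolding rows_det_linear by (simp add: upd)
qed

text \<open>The form \<open>D\<close>, extended coefficientwise to polynomials in \<open>T\<close>, is evaluated on the partial product
  over \<open>S\<close> applied to a pure tensor. Each new factor \<open>T - f(X\<^sub>k)\<close> acts on row \<open>k\<close> only, and
  linearity of the determinant in that row gives the induction step.\<close>

lemma map_poly_det_form_prod:
  fixes y :: "'n::finite \<Rightarrow> 'a poly"
  assumes "m = CARD('n)"
  shows "map_poly (tensor_form det_form) ((\<Prod>i\<in>S. [:0, 1:] - [:tensor_at i f:]) * [:tensor y:])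
    = rows_det (\<lambda>k j. if k \<in> S then [:- coord (f * y k) j, coord (y k) j:] else [:coord (y k) j:])"
proof -
  note form = multilinear_form_det_form[OF assms]
  have "finite S" by simp
  then show ?thesis
  proof (induction S arbitrary: y rule: finite_induct)
    case empty
    have "map_poly (tensor_form det_form) [:tensor y:] = [:tensor_form det_form (tensor y):]"
      by (rule poly_eqI)
        (simp add: coeff_map_poly coeff_pCons tensor_form_0[OF form] split: nat.split)
    then show ?case
      by (simp add: tensor_form_tensor[OF form] rows_det_const) (simp add: det_form_def)
  next
    case (insert k S)
    let ?P = "\<Prod>i\<in>S. [:0, 1:] - [:tensor_at i f:] :: ('a, 'n) tensor_power poly"
    let ?y = "y(k := f * y k)"
    let ?R = "\<lambda>y k j. if k \<in> S then [:- coord (f * y k) j, coord (y k) j:] else [:coord (y k) j:]"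
    have expand: "(\<Prod>i\<in>insert k S. [:0, 1:] - [:tensor_at i f:]) * [:tensor y:]
      = pCons 0 (?P * [:tensor y:]) - ?P * [:tensor ?y:]"
    proof -
      have distrib: "(X - a) * p * c = X * (p * c) - p * (a * c)"
        for X a p c :: "('a, 'n) tensor_power poly"
        by (simp add: algebra_simps)
      show ?thesis
        unfolding prod.insert[OF insert.hyps] distrib
        by (simp add: tensor_at_mult_tensor mult.commute[of "tensor y"])
    qed
    have linear: "map_poly (tensor_form det_form) (pCons 0 p - q)
      = pCons 0 (map_poly (tensor_form det_form) p) - map_poly (tensor_form det_form) q"
      for p q :: "('a, 'n) tensor_power poly"
    proof (rule poly_eqI)
      fix d
      have "tensor_form det_form (coeff (pCons 0 p) d - coeff q d)
        = coeff (pCons 0 (map_poly (tensor_form det_form) p)) d - tensor_form det_form (coeff q d)"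
        unfolding tensor_form_diff[OF form]
        by (cases d) (simp_all add: coeff_map_poly tensor_form_0[OF form])
      then show "coeff (map_poly (tensor_form det_form) (pCons 0 p - q)) d
        = coeff (pCons 0 (map_poly (tensor_form det_form) p) - map_poly (tensor_form det_form) q) d"
        by (simp only: coeff_map_poly[of "tensor_form det_form", OF tensor_form_0[OF form]] coeff_diff)
    qed
    have "map_poly (tensor_form det_form)
        ((\<Prod>i\<in>insert k S. [:0, 1:] - [:tensor_at i f:]) * [:tensor y:])
      = [:0, 1:] * rows_det (?R y) + (- 1) * rows_det (?R ?y)"
      unfolding expand linear insert.IH by simp
    also have "rows_det (?R y) = rows_det ((?R y)(k := \<lambda>j. [:coord (y k) j:]))"
      using insert.hyps by (intro rows_det_cong) auto
    also have "rows_det (?R ?y) = rows_det ((?R y)(k := \<lambda>j. [:coord (f * y k) j:]))"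
      using insert.hyps by (intro rows_det_cong) auto
    also have "[:0, 1:] * rows_det ((?R y)(k := \<lambda>j. [:coord (y k) j:]))
        + (- 1) * rows_det ((?R y)(k := \<lambda>j. [:coord (f * y k) j:]))
      = rows_det ((?R y)(k := \<lambda>j. [:0, 1:] * [:coord (y k) j:] + (- 1) * [:coord (f * y k) j:]))"
      by (rule rows_det_linear[symmetric])
    also have "\<dots> = rows_det (\<lambda>k' j. if k' \<in> insert k S
        then [:- coord (f * y k') j, coord (y k') j:] else [:coord (y k') j:])"
      by (intro rows_det_cong) auto
    finally show ?case .
  qed
qed

text \<open>The matrix on the left is the matrix of the coordinates of the \<open>y\<^sub>k\<close>, multiplied from the
  right by the transpose of \<open>T 1 - M\<close>, where \<open>M\<close> is the matrix of multiplication by \<open>f\<close>.\<close>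

lemma rows_det_char_poly:
  fixes y :: "'n::finite \<Rightarrow> 'a poly"
  assumes m: "m = CARD('n)"
  shows "rows_det (\<lambda>k j. [:- coord (f * y k) j, coord (y k) j:])
    = [:det_form y:] * char_poly (mult_mat f)"
proof -
  let ?C = "char_poly_matrix (mult_mat f)"
  let ?Y = "mat m m (\<lambda>(i, j). [:coord (y (nth_factor i)) j:])"
  have C: "?C \<in> carrier_mat m m" by simp
  have "mat m m (\<lambda>(i, j). [:- coord (f * y (nth_factor i)) j, coord (y (nth_factor i)) j:])
    = ?Y * transpose_mat ?C"
  proof (rule eq_matI)
    fix i j
    assume "i < dim_row (?Y * transpose_mat ?C)" "j < dim_col (?Y * transpose_mat ?C)"
    then have ij: "i < m" "j < m" using carrier_matD[OF C] by auto
    let ?c = "coord (y (nth_factor i))"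
    have "(?Y * transpose_mat ?C) $$ (i, j) = (\<Sum>l<m. [:?c l:] * ?C $$ (j, l))"
      using ij carrier_matD[OF C] by (auto simp: scalar_prod_def atLeast0LessThan)
    also have "\<dots> = (\<Sum>l<m. (if l = j then [:0, ?c l:] else 0) - [:mult_mat f $$ (j, l) * ?c l:])"
    proof (intro sum.cong refl)
      fix l assume "l \<in> {..<m}"
      then have "?C $$ (j, l) = (if j = l then [:0, 1:] else 0) - [:mult_mat f $$ (j, l):]"
        using ij carrier_matD[OF mult_mat_carrier[of f]] by (simp add: char_poly_matrix_def)
      then show "[:?c l:] * ?C $$ (j, l)
        = (if l = j then [:0, ?c l:] else 0) - [:mult_mat f $$ (j, l) * ?c l:]"
        by (auto simp: smult_diff_right mult.commute)
    qed
    also have "\<dots> = [:0, ?c j:] - (\<Sum>l<m. [:mult_mat f $$ (j, l) * ?c l:])"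
      using ij by (simp add: sum_subtractf)
    also have "(\<Sum>l<m. [:mult_mat f $$ (j, l) * ?c l:]) = [:coord (f * y (nth_factor i)) j:]"
      by (simp add: coord_mult[OF ij(2)] sum_to_poly)
    finally show "mat m m (\<lambda>(i, j). [:- coord (f * y (nth_factor i)) j, coord (y (nth_factor i)) j:]) $$ (i, j)
      = (?Y * transpose_mat ?C) $$ (i, j)"
      using ij by simp
  qed (use carrier_matD[OF C] in auto)
  then have "rows_det (\<lambda>k j. [:- coord (f * y k) j, coord (y k) j:]) = det (?Y * transpose_mat ?C)"
    by (simp add: rows_det_def m)
  also have "\<dots> = det ?Y * det ?C"
    using det_transpose[OF C] by (subst det_mult[of _ m]) auto
  also have "det ?Y = [:det_form y:]"
    using rows_det_const[of "\<lambda>k. coord (y k)"] by (simp add: rows_det_def det_form_def m)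
  finally show ?thesis by (simp add: char_poly_def)
qed

text \<open>The heart of the matter: the coefficients of the characteristic polynomial of multiplication
  by \<open>f\<close> are, up to sign, the scalars by which the \<open>s\<^sub>k(f)\<close> act on the determinant form.\<close>

lemma det_form_sym_tensor_mult:
  fixes t :: "('a, 'n::finite) tensor_power"
  assumes m: "m = CARD('n)"
  shows "tensor_form det_form (sym_tensor k f * t)
    = (- 1) ^ k * coeff (char_poly (mult_mat f)) (CARD('n) - k) * tensor_form det_form t"
proof (induction t rule: tensor_induct)
  note form = multilinear_form_det_form[OF m]
  case (scaled a y)
  let ?P = "\<Prod>i\<in>(UNIV :: 'n set). [:0, 1:] - [:tensor_at i f:]"
  have "map_poly (tensor_form det_form) (?P * [:tensor y:])
    = [:det_form y:] * char_poly (mult_mat f)"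
    using map_poly_det_form_prod[OF m, where S = UNIV and f = f and y = y]
      rows_det_char_poly[OF m, of f y] by simp
  then have "coeff (map_poly (tensor_form det_form) (?P * [:tensor y:])) (CARD('n) - k)
    = det_form y * coeff (char_poly (mult_mat f)) (CARD('n) - k)"
    by simp
  then have P: "tensor_form det_form (coeff ?P (CARD('n) - k) * tensor y)
    = det_form y * coeff (char_poly (mult_mat f)) (CARD('n) - k)"
    by (simp add: coeff_map_poly tensor_form_0[OF form] mult.commute)
  have eq: "sym_tensor k f * (tensor_scalar a * tensor y)
    = tensor_scalar ((- 1) ^ k * a) * (coeff ?P (CARD('n) - k) * tensor y)"
    by (simp add: sym_tensor_def tensor_scalar_mult tensor_scalar_power tensor_scalar_uminus mult_ac)
  show ?case
    unfolding eq tensor_form_scalar[OF form] P tensor_form_tensor[OF form]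
    by (simp add: mult_ac)
next
  case (add s t)
  then show ?case
    by (simp add: distrib_left tensor_form_add[OF multilinear_form_det_form[OF m]])
qed

text \<open>The tensor of the basis elements, on which the determinant form takes the value \<open>1\<close>. It lets
  one read off the scalar by which a symmetric tensor acts.\<close>

definition basis_tensor :: "('a, 'n::finite) tensor_power"
  where "basis_tensor = tensor (\<lambda>k. b (factor_index k))"

lemma det_form_basis_tensor:
  assumes m: "m = CARD('n::finite)"
  shows "tensor_form det_form (basis_tensor :: ('a, 'n) tensor_power) = 1"
proof -
  have "mat CARD('n) CARD('n) (\<lambda>(i, j). coord (b (factor_index (nth_factor i :: 'n))) j) = 1\<^sub>m CARD('n)"
    by (rule eq_matI) (auto simp: coord_basis m)
  then show ?thesis
    by (simp add: basis_tensor_def tensor_form_tensor[OF multilinear_form_det_form[OF m]]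
        det_form_def rows_det_def)
qed

text \<open>Acting by a scalar is preserved under sums, products and scalar multiples, so it passes from
  the generators to the algebra that they generate.\<close>

lemma det_form_elementary_mult:
  fixes s t :: "('a, 'n::finite) tensor_power"
  assumes m: "m = CARD('n)" and "s \<in> elementary_algebra"
  shows "tensor_form det_form (s * t)
    = tensor_form det_form (s * basis_tensor) * tensor_form det_form t"
proof -
  note form = multilinear_form_det_form[OF m]
  note D1 = det_form_basis_tensor[OF m]
  show ?thesis
    using assms(2)
  proof (induction arbitrary: t rule: elementary_algebra.induct)
    case elementary_one
    then show ?case by (simp add: D1)
  next
    case (elementary_gen k)
    then show ?case by (simp add: det_form_sym_tensor_mult[OF m] D1)
  next
    case (elementary_add r s)
    show ?case
      by (simp add: distrib_right tensor_form_add[OF form] elementary_add.IH(1)[of t]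
          elementary_add.IH(2)[of t])
  next
    case (elementary_mult r s)
    show ?case
      unfolding mult.assoc[of r s] elementary_mult.IH(1)[of "s * t"]
        elementary_mult.IH(1)[of "s * basis_tensor"] elementary_mult.IH(2)[of t]
      by (rule mult.assoc[symmetric])
  next
    case (elementary_scalar s a)
    show ?case
      by (simp add: mult.assoc tensor_form_scalar[OF form] elementary_scalar.IH[of t])
  qed
qed

text \<open>Existence of \<open>u\<^sub>F\<close> together with an explicit formula for it.\<close>

lemma u_hom_eq_det_form:
  fixes t :: "('a, 'n::finite) tensor_power"
  assumes F: "monic F" "degree F = CARD('n)" and t: "t \<in> symmetric_tensors"
  shows "u_hom F t = tensor_form det_form (t * basis_tensor)"
proof -
  have m: "m = CARD('n)" using card_basis_eq_degree[OF F(1)] F(2) by simp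
  note form = multilinear_form_det_form[OF m]
  note D1 = det_form_basis_tensor[OF m]
  let ?Sym = "symmetric_tensors :: ('a, 'n) tensor_power set"
  let ?u = "restrict (\<lambda>t. tensor_form det_form (t * basis_tensor)) ?Sym"
  have "is_sym_alg_hom ?u"
    unfolding is_sym_alg_hom_def
  proof (intro conjI ballI allI)
    fix s t :: "('a, 'n) tensor_power" and a
    assume s: "s \<in> ?Sym" and t: "t \<in> ?Sym"
    show "?u (s + t) = ?u s + ?u t"
      using s t symmetric_tensors_add[OF s t] by (simp add: distrib_right tensor_form_add[OF form])
    have "s \<in> elementary_algebra" using s by (simp add: symmetric_tensors_eq_elementary_algebra)
    then show "?u (s * t) = ?u s * ?u t"
      using s t symmetric_tensors_mult[OF s t] det_form_elementary_mult[OF m, of s "t * basis_tensor"]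
      by (simp add: mult.assoc)
  next
    fix a and t :: "('a, 'n) tensor_power"
    assume t: "t \<in> ?Sym"
    show "?u (tensor_scalar a * t) = a * ?u t"
      using t symmetric_tensors_scalar[OF t, of a] by (simp add: mult.assoc tensor_form_scalar[OF form])
  qed (simp add: symmetric_tensors_1 D1)
  moreover have "?u (sym_tensor i [:0, 1:]) = (- 1) ^ i * coeff F (CARD('n) - i)"
    if "i \<in> {1..CARD('n)}" for i
  proof -
    have "(sym_tensor i [:0, 1:] :: ('a, 'n) tensor_power) \<in> ?Sym"
      using that by (intro sym_tensor_symmetric) simp
    then show ?thesis
      using F by (simp add: det_form_sym_tensor_mult[OF m] D1 char_poly_mult_X)
  qed
  ultimately have u: "?u \<in> extensional ?Sym \<and> is_sym_alg_hom ?u \<and>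
    (\<forall>i\<in>{1..CARD('n)}. ?u (sym_tensor i [:0, 1:]) = (- 1) ^ i * coeff F (CARD('n) - i))"
    by simp
  have "u_hom F = ?u"
    unfolding u_hom_def
  proof (rule the_equality)
    fix v :: "('a, 'n) tensor_power \<Rightarrow> 'a"
    assume v: "v \<in> extensional ?Sym \<and> is_sym_alg_hom v \<and>
      (\<forall>i\<in>{1..CARD('n)}. v (sym_tensor i [:0, 1:]) = (- 1) ^ i * coeff F (CARD('n) - i))"
    have "v s = ?u s" if "s \<in> ?Sym" for s
    proof (rule sym_alg_hom_unique[OF _ _ _ that])
      show "is_sym_alg_hom v" "is_sym_alg_hom ?u" using u v by blast+
      fix i assume "i \<in> {1..CARD('n)}"
      then have "v (sym_tensor i [:0, 1:]) = (- 1) ^ i * coeff F (CARD('n) - i)"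
        and "?u (sym_tensor i [:0, 1:]) = (- 1) ^ i * coeff F (CARD('n) - i)"
        using u v by blast+
      then show "v (sym_tensor i [:0, 1:]) = ?u (sym_tensor i [:0, 1:])" by (rule trans[OF _ sym])
    qed
    then show "v = ?u"
      using u v by (intro extensionalityI[of v ?Sym ?u]) blast+
  qed (rule u)
  then show ?thesis using t by simp
qed

lemma u_hom_sym_tensor:
  assumes F: "monic F" "degree F = CARD('n)" and k: "k \<le> CARD('n::finite)"
  shows "u_hom F (sym_tensor k f :: ('a, 'n) tensor_power)
    = (- 1) ^ k * coeff (char_poly (mult_mat f)) (CARD('n) - k)"
proof -
  have m: "m = CARD('n)" using card_basis_eq_degree[OF F(1)] F(2) by simp
  show ?thesis
    by (simp add: u_hom_eq_det_form[OF F sym_tensor_symmetric[OF k]] det_form_sym_tensor_mult[OF m]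
        det_form_basis_tensor[OF m])
qed

end

lemma sym_tensor_top:
  "(sym_tensor CARD('n) f :: ('a::comm_ring_1, 'n::finite) tensor_power) = tensor (\<lambda>_. f)"
proof -
  have "{S :: 'n set. card S = CARD('n)} = {UNIV}"
    by (auto dest: card_eq_UNIV_imp_eq_UNIV[OF finite])
  then show ?thesis by (simp add: sym_tensor_expand)
qed

lemma coeff_0_char_poly:
  assumes "A \<in> carrier_mat n n"
  shows "coeff (char_poly A) 0 = (- 1) ^ n * det A"
proof -
  interpret comm_ring_hom "\<lambda>p :: 'a poly. coeff p 0"
    by unfold_locales (auto simp: coeff_mult_0)
  have "map_mat (\<lambda>p. coeff p 0) (char_poly_matrix A) = (- 1) \<cdot>\<^sub>m A"
    using assms by (intro eq_matI) (auto simp: char_poly_matrix_def)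
  then have "coeff (char_poly A) 0 = det ((- 1) \<cdot>\<^sub>m A)"
    unfolding char_poly_def by (metis hom_det)
  then show ?thesis using assms by simp
qed

lemma char_poly_expand:
  assumes "A \<in> carrier_mat n n"
  shows "char_poly A = monom 1 n + (\<Sum>i = 1..n. monom (coeff (char_poly A) (n - i)) (n - i))"
proof -
  note deg = degree_monic_char_poly[OF assms]
  have reverse: "(\<Sum>i = 1..n. monom (coeff (char_poly A) (n - i)) (n - i))
    = (\<Sum>i<n. monom (coeff (char_poly A) i) i)"
    by (rule sum.reindex_bij_witness[of _ "\<lambda>i. n - i" "\<lambda>i. n - i"]) auto
  have "char_poly A = (\<Sum>i<n. monom (coeff (char_poly A) i) i) + monom 1 n"
    using deg poly_as_sum_of_monoms[of "char_poly A"] by (simp add: lessThan_Suc_atMost[symmetric])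
  then show ?thesis
    unfolding reverse by (subst add.commute)
qed

section \<open>Bases of the quotient module\<close>

lemma residue_class_eq_set: "residue_class F p = {q. F dvd q - p}"
proof (intro equalityI subsetI)
  fix q assume "q \<in> residue_class F p"
  then obtain x where "q = x * F + p"
    by (auto simp: residue_class_def a_r_coset_def' cgenideal_def)
  then show "q \<in> {q. F dvd q - p}" by simp
next
  fix q assume "q \<in> {q. F dvd q - p}"
  then obtain x where "q - p = F * x" by auto
  then have "q = x * F + p" by (simp add: algebra_simps)
  then show "q \<in> residue_class F p"
    by (auto simp: residue_class_def a_r_coset_def' cgenideal_def)
qed

lemma residue_class_eq_iff: "residue_class F p = residue_class F q \<longleftrightarrow> F dvd p - q"
proof
  assume "residue_class F p = residue_class F q"
  moreover have "p \<in> residue_class F p" by (simp add: residue_class_eq_set)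
  ultimately show "F dvd p - q" by (simp add: residue_class_eq_set)
next
  assume pq: "F dvd p - q"
  have "F dvd r - p \<longleftrightarrow> F dvd r - q" for r
    using dvd_add_right_iff[OF pq, of "r - p"] by (simp add: algebra_simps)
  then show "residue_class F p = residue_class F q" by (simp add: residue_class_eq_set)
qed

lemma ideal_PIdl: "ideal (PIdl\<^bsub>class_ring\<^esub> F) (class_ring :: 'a::comm_ring_1 poly ring)"
  by (rule cring.cgenideal_ideal[OF class_cring.cring_axioms]) simp

lemma ring_quot_ring: "ring (quot_ring F)"
  unfolding quot_ring_def by (rule ideal.quotient_is_ring[OF ideal_PIdl])

lemma carrier_quot_ring: "carrier (quot_ring F) = range (residue_class F)"
  by (auto simp: quot_ring_def residue_class_def FactRing_def A_RCOSETS_def' )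

lemma residue_class_ring_hom: "residue_class F \<in> ring_hom class_ring (quot_ring F)"
  unfolding quot_ring_def residue_class_def by (rule ideal.rcos_ring_hom[OF ideal_PIdl])

lemma residue_class_mult:
  "residue_class F p \<otimes>\<^bsub>quot_ring F\<^esub> residue_class F q = residue_class F (p * q)"
  using ring_hom_mult[OF residue_class_ring_hom, of p q] by simp

lemma residue_class_add:
  "residue_class F p \<oplus>\<^bsub>quot_ring F\<^esub> residue_class F q = residue_class F (p + q)"
  using ring_hom_add[OF residue_class_ring_hom, of p q] by simp

lemma residue_class_0: "residue_class F 0 = \<zero>\<^bsub>quot_ring F\<^esub>"
  by (rule ring_hom_zero[OF residue_class_ring_hom class_ring.ring_axioms ring_quot_ring, simplified])

lemma carrier_quot_module: "carrier (quot_module F) = range (residue_class F)"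
  by (simp add: quot_module_def carrier_quot_ring)

lemma abelian_monoid_quot_module: "abelian_monoid (quot_module F)"
proof -
  interpret ring "quot_ring F" by (rule ring_quot_ring)
  show ?thesis
    by (rule abelian_monoidI) (simp_all add: quot_module_def a_ac)
qed

lemma finsum_residue_class:
  "(\<Oplus>\<^bsub>quot_module F\<^esub>i\<in>A. residue_class F (g i)) = residue_class F (sum g A)"
proof -
  interpret abelian_monoid "quot_module F" by (rule abelian_monoid_quot_module)
  have zero: "residue_class F 0 = \<zero>\<^bsub>quot_module F\<^esub>"
    by (simp add: quot_module_def residue_class_0)
  have add: "residue_class F p \<oplus>\<^bsub>quot_module F\<^esub> residue_class F q = residue_class F (p + q)" for p q
    by (simp add: quot_module_def residue_class_add)
  show ?thesis
    by (induction A rule: infinite_finite_induct)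
      (simp_all add: finsum_infinite zero carrier_quot_module add)
qed

text \<open>Coordinates in the quotient module are translated into a divisibility between polynomials.\<close>

lemma has_coords_residue_class:
  assumes "\<And>i. i < length bs \<Longrightarrow> bs ! i = residue_class F (b i)"
  shows "has_coords (quot_module F) bs (residue_class F p) c \<longleftrightarrow> c \<in> carrier_vec (length bs) \<and>
    F dvd p - (\<Sum>i<length bs. Polynomial.smult (c $ i) (b i))"
proof -
  interpret abelian_monoid "quot_module F" by (rule abelian_monoid_quot_module)
  have "(\<Oplus>\<^bsub>quot_module F\<^esub>i\<in>{..<length bs}. (c $ i) \<odot>\<^bsub>quot_module F\<^esub> (bs ! i))
    = (\<Oplus>\<^bsub>quot_module F\<^esub>i\<in>{..<length bs}. residue_class F (Polynomial.smult (c $ i) (b i)))"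
    by (rule finsum_cong')
      (auto simp: carrier_quot_module, auto simp: quot_module_def assms residue_class_mult)
  then show ?thesis
    by (simp add: has_coords_def finsum_residue_class residue_class_eq_iff)
qed

lemma free_basis_imp_basis_mod:
  assumes "is_free_basis (quot_module F) bs"
  obtains b coord where "basis_mod F b coord (length bs)"
    and "\<And>i. i < length bs \<Longrightarrow> bs ! i = residue_class F (b i)"
    and "\<And>p. coords (quot_module F) bs (residue_class F p) = vec (length bs) (coord p)"
proof -
  let ?M = "quot_module F"
  have "\<exists>p. bs ! i = residue_class F p" if "i < length bs" for i
  proof -
    have "bs ! i \<in> range (residue_class F)"
      using assms nth_mem[OF that] unfolding is_free_basis_def carrier_quot_module by blast
    then show ?thesis by auto
  qed
  then obtain b where b: "bs ! i = residue_class F (b i)" if "i < length bs" for i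
    by metis
  define coord where "coord = (\<lambda>p i. coords ?M bs (residue_class F p) $ i)"
  have has: "has_coords ?M bs (residue_class F p) c \<longleftrightarrow> c \<in> carrier_vec (length bs) \<and>
    F dvd p - (\<Sum>i<length bs. Polynomial.smult (c $ i) (b i))" for p c
    by (rule has_coords_residue_class) (rule b)
  have ex1: "\<exists>!c. has_coords ?M bs (residue_class F p) c" for p
    using assms by (auto simp: is_free_basis_def carrier_quot_module)
  have coords: "has_coords ?M bs (residue_class F p) (coords ?M bs (residue_class F p))" for p
    unfolding coords_def by (rule theI') (rule ex1)
  have "basis_mod F b coord (length bs)"
  proof
    show "F dvd p - (\<Sum>i<length bs. Polynomial.smult (coord p i) (b i))" for p
      using coords[of p] unfolding coord_def has by simp
  next
    fix c :: "nat \<Rightarrow> 'a" and i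
    assume dvd: "F dvd (\<Sum>i<length bs. Polynomial.smult (c i) (b i))" and i: "i < length bs"
    have "has_coords ?M bs (residue_class F 0) (vec (length bs) c)"
      unfolding has using dvd by simp
    moreover have "has_coords ?M bs (residue_class F 0) (0\<^sub>v (length bs))"
      unfolding has by simp
    ultimately have "vec (length bs) c = 0\<^sub>v (length bs)"
      using ex1[of 0] by blast
    then have "vec (length bs) c $ i = 0\<^sub>v (length bs) $ i" by simp
    then show "c i = 0" using i by simp
  qed
  moreover have "coords ?M bs (residue_class F p) = vec (length bs) (coord p)" for p
    using coords[of p] unfolding has by (intro eq_vecI) (auto simp: coord_def)
  ultimately show ?thesis using b that by blast
qed

lemma (in basis_mod) free_basis: "is_free_basis (quot_module F) (map (\<lambda>i. residue_class F (b i)) [0..<m])"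
proof -
  let ?M = "quot_module F"
  let ?bs = "map (\<lambda>i. residue_class F (b i)) [0..<m]"
  have has: "has_coords ?M ?bs (residue_class F p) c \<longleftrightarrow> c \<in> carrier_vec m \<and>
    F dvd p - (\<Sum>i<m. Polynomial.smult (c $ i) (b i))" for p c
    by (subst has_coords_residue_class[of ?bs F b]) auto
  have "\<exists>!c. has_coords ?M ?bs (residue_class F p) c" for p
  proof
    show "has_coords ?M ?bs (residue_class F p) (vec m (coord p))"
      unfolding has using expand[of p] by simp
    fix c assume "has_coords ?M ?bs (residue_class F p) c"
    then show "c = vec m (coord p)"
      unfolding has using coord_unique[of p "\<lambda>i. c $ i"] by (intro eq_vecI) auto
  qed
  then show ?thesis by (auto simp: is_free_basis_def carrier_quot_module)
qed

section \<open>The characteristic polynomial of multiplication by a residue class\<close>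

theorem theorem2p4:
  fixes F f :: "'a::comm_ring_1 poly"
  assumes "monic F"
    and "degree F = CARD('n::finite)"
  shows "endo_char_poly (quot_module F) (mult_endo F f) =
      monom 1 CARD('n) + (\<Sum>i = 1..CARD('n).
        monom ((- 1) ^ i * u_hom F (sym_tensor i f :: ('a, 'n) tensor_power)) (CARD('n) - i))
    \<and> endo_det (quot_module F) (mult_endo F f)
      = u_hom F (tensor (\<lambda>_. f) :: ('a, 'n) tensor_power)"
proof -
  let ?M = "quot_module F"
  \<comment> \<open>The characteristic polynomial is taken in a basis about which nothing else is known.\<close>
  define bs where "bs = some_basis ?M"
  have pos: "0 < degree F" using assms(2) by simp
  obtain coord' where "basis_mod F (monom 1) coord' (degree F)"
    using basis_mod_monom[OF assms(1) pos] .
  then have "is_free_basis ?M bs"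
    unfolding bs_def some_basis_def by (rule someI[of "is_free_basis ?M", OF basis_mod.free_basis])
  then obtain b coord where basis: "basis_mod F b coord (length bs)"
    and b: "\<And>i. i < length bs \<Longrightarrow> bs ! i = residue_class F (b i)"
    and coords: "\<And>p. coords ?M bs (residue_class F p) = vec (length bs) (coord p)"
    using free_basis_imp_basis_mod by blast
  interpret basis_mod F b coord "length bs" by (rule basis)
  have n: "length bs = CARD('n)"
    using card_basis_eq_degree[OF assms(1) pos] assms(2) by simp
  let ?\<chi> = "char_poly (mult_mat f)"
  have mat: "endo_mat ?M bs (mult_endo F f) = mult_mat f"
    by (rule eq_matI)
      (auto simp: endo_mat_def mult_mat_def mult_endo_def b residue_class_mult coords)
  have sign: "(- 1) ^ k * ((- 1) ^ k * x) = x" for k and x :: 'a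
    by (simp flip: mult.assoc power_mult_distrib)
  have coeff: "coeff ?\<chi> (CARD('n) - k)
    = (- 1) ^ k * u_hom F (sym_tensor k f :: ('a, 'n) tensor_power)" if "k \<le> CARD('n)" for k
    using u_hom_sym_tensor[OF assms that] by (simp add: sign)
  have "?\<chi> = monom 1 CARD('n)
      + (\<Sum>i = 1..CARD('n). monom (coeff ?\<chi> (CARD('n) - i)) (CARD('n) - i))"
    using char_poly_expand[OF mult_mat_carrier[of f]] unfolding n .
  also have "\<dots> = monom 1 CARD('n) + (\<Sum>i = 1..CARD('n).
      monom ((- 1) ^ i * u_hom F (sym_tensor i f :: ('a, 'n) tensor_power)) (CARD('n) - i))"
    by (simp add: coeff)
  finally have char_poly: "?\<chi> = \<dots>" .
  have "u_hom F (tensor (\<lambda>_. f) :: ('a, 'n) tensor_power) = (- 1) ^ CARD('n) * coeff ?\<chi> 0"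
    using u_hom_sym_tensor[OF assms order_refl, of f] by (simp add: sym_tensor_top)
  also have "\<dots> = det (mult_mat f)"
    using coeff_0_char_poly[OF mult_mat_carrier[of f]] by (simp add: n sign)
  finally have det: "det (mult_mat f) = u_hom F (tensor (\<lambda>_. f) :: ('a, 'n) tensor_power)" ..
  show ?thesis
    using char_poly det by (simp add: endo_char_poly_def endo_det_def mat flip: bs_def)
qed

end
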